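(* Let $m>0$, let $U:\mathbb{R}^d\to\mathbb{R}$ be $m$-convex, continuously differentiable and $L$-gradient Lipschitz, and let $\pi$ be the probability measure with Lebesgue density $e^{-U}/\int e^{-U}$. Let $(\gamma_k)_{k\ge1}$ be a non-increasing sequence of positive real numbers with $\gamma_1\in(0,L^{-1}]$, and let $\mu_0\in\mathcal{P}_2(\mathbb{R}^d)$. Then for all $n\ge1$, with $Q_\gamma^n=R_{\gamma_1}\cdots R_{\gamma_n}$, $$W_2^2(\mu_0Q_\gamma^n,\pi)\le\Big\{\prod_{k=1}^n(1-m\gamma_k)\Big\}W_2^2(\mu_0,\pi)+2Ld\sum_{k=1}^n\gamma_k^2\prod_{i=k+1}^n(1-m\gamma_i).$$
   Context: $\mathcal{P}_2(\mathbb{R}^d)$ is the set of Borel probability measures on $\mathbb{R}^d$ with finite second moment; $W_2$ is the Wasserstein distance of order 2 for the Euclidean norm. $U$ is $m$-convex if $U(tx+(1-t)y)\le tU(x)+(1-t)U(y)-t(1-t)(m/2)\|x-y\|^2$ for all $x,y\in\mathbb{R}^d$, $t\in[0,1]$. $L$-gradient Lipschitz means $\|\nabla U(x)-\nabla U(y)\|\le L\|x-y\|$ for all $x,y$. For $\gamma>0$, $R_\gamma$ is the Markov kernel of the Unadjusted Langevin Algorithm: $R_\gamma(x,A)=(4\pi\gamma)^{-d/2}\int_A\exp(-\|y-x+\gamma\nabla U(x)\|^2/(4\gamma))\,dy$ (in the normalizing factor $\pi$ is the number), i.e. $R_\gamma(x,\cdot)$ is the law of $x-\gamma\nabla U(x)+\sqrt{2\gamma}\,G$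 with $G$ standard Gaussian in $\mathbb{R}^d$. For a probability measure $\mu$ and a kernel $K$, $\mu K(A)=\int K(x,A)\,d\mu(x)$; products of kernels are compositions applied from left to right. An empty product equals $1$. *)

theory Defs
  imports "HOL-Probability.Probability"
begin

definition P2 :: "'a::euclidean_space measure set" where
  "P2 = {\<mu>. sets \<mu> = sets borel \<and> prob_space \<mu> \<and> (\<integral>\<^sup>+ x. ennreal ((norm x)\<^sup>2) \<partial>\<mu>) < \<infinity>}"

definition couplings ::
  "'a::euclidean_space measure \<Rightarrow> 'a measure \<Rightarrow> ('a \<times> 'a) measure set" where
  "couplings \<mu> \<nu> = {\<xi>. sets \<xi> = sets (borel \<Otimes>\<^sub>M borel) \<and> prob_space \<xi> \<and>
     distr \<xi> borel fst = \<mu> \<and> distr \<xi> borel snd = \<nu>}"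

definition ennreal_sqrt :: "ennreal \<Rightarrow> ennreal" where
  "ennreal_sqrt x = (if x = \<infinity> then \<infinity> else ennreal (sqrt (enn2real x)))"

(* Extended-valued, so that an infinite transport cost is never mistaken for 0. *)
definition W2 :: "'a::euclidean_space measure \<Rightarrow> 'a measure \<Rightarrow> ennreal" where
  "W2 \<mu> \<nu> = ennreal_sqrt
     (INF \<xi> \<in> couplings \<mu> \<nu>. \<integral>\<^sup>+ z. ennreal ((norm (fst z - snd z))\<^sup>2) \<partial>\<xi>)"

definition m_convex :: "real \<Rightarrow> ('a::euclidean_space \<Rightarrow> real) \<Rightarrow> bool" where
  "m_convex m U \<longleftrightarrow> (\<forall>x y. \<forall>t\<in>{0..1}.
     U (t *\<^sub>R x + (1 - t) *\<^sub>R y)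
       \<le> t * U x + (1 - t) * U y - t * (1 - t) * (m / 2) * (norm (x - y))\<^sup>2)"

definition gibbs :: "('a::euclidean_space \<Rightarrow> real) \<Rightarrow> 'a measure" where
  "gibbs U = density lborel (\<lambda>x. ennreal (exp (- U x) / (\<integral>y. exp (- U y) \<partial>lborel)))"

(* gU stands for the gradient of the potential. *)
definition ula_kernel ::
  "('a::euclidean_space \<Rightarrow> 'a) \<Rightarrow> real \<Rightarrow> 'a \<Rightarrow> 'a measure" where
  "ula_kernel gU \<gamma> x = density lborel (\<lambda>y. ennreal
     ((4 * pi * \<gamma>) powr (- real DIM('a) / 2)
       * exp (- (norm (y - x + \<gamma> *\<^sub>R gU x))\<^sup>2 / (4 * \<gamma>))))"

(* The kernel product R_(gamma 1) ... R_(gamma n), left to right: starting at x, the step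
   gamma 1 is performed first. *)
fun ula_iter ::
  "('a::euclidean_space \<Rightarrow> 'a) \<Rightarrow> (nat \<Rightarrow> real) \<Rightarrow> nat \<Rightarrow> 'a \<Rightarrow> 'a measure" where
  "ula_iter gU \<gamma> 0 x = return borel x"
| "ula_iter gU \<gamma> (Suc n) x = bind (ula_iter gU \<gamma> n x) (ula_kernel gU (\<gamma> (Suc n)))"

end

theory Submission
  imports Defs
begin

text \<open>One step of the algorithm is a gradient step \<open>x \<mapsto> x - \<gamma> \<nabla>U(x)\<close> followed by the heat flow for time
  \<open>\<gamma>\<close>. By strong convexity the gradient step \<open>\<mu> \<mapsto> \<mu>'\<close> satisfies
  \<open>W2\<^sup>2(\<mu>', \<pi>) \<le> (1 - m \<gamma>) W2\<^sup>2(\<mu>, \<pi>) - 2 \<gamma> (\<mu>'(U) - \<pi>(U))\<close>.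
  The heat flow gives back \<open>W2\<^sup>2(\<nu>', \<pi>) \<le> W2\<^sup>2(\<nu>, \<pi>) + 2 \<gamma> (\<nu>(U) + L \<gamma> d - \<pi>(U))\<close>, and the
  energies cancel in the sum. This second bound would follow by coupling \<open>x\<close> moving by Brownian motion
  with \<open>y\<close> moving by the stationary Langevin diffusion driven by the same noise. To stay in discrete time,
  \<open>[0, \<gamma>]\<close> is cut into \<open>N\<close> pieces of length \<open>t\<close>, and \<open>y\<close> is moved by a random walk Metropolis step with the
  Gaussian increment \<open>z\<close> added to \<open>x\<close>. This leaves \<open>\<pi>\<close> exactly invariant, and a rejection
  (probability about \<open>max 0 (\<nabla>U(y) \<bullet> z)\<close>) changes the expected squared distance by
  \<open>2 t ((x - y) \<bullet> \<nabla>U(y)) \<le> 2 t (U(x) - U(y))\<close> up to \<open>O(t\<^bsup>3/2\<^esup>)\<close>, an error that disappears as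
  \<open>N\<close> tends to infinity.\<close>

section \<open>The Gaussian heat kernel\<close>

text \<open>The obstacle is the second marginal. The coupling must end in \<open>gibbs U\<close>
  itself, so the partner \<open>y\<close> has to keep this law exactly, and an Euler step for
  \<open>y\<close> would bring in a bias of its own. Rejection keeps the law and at the same time
  produces the drift: \<open>y\<close> fails to follow \<open>z\<close> mostly when
  \<open>gradU y \<bullet> z > 0\<close>, so to leading order its mean displacement is
  \<open>- t *\<^sub>R gradU y\<close>, as for the Langevin diffusion. When the move is accepted,
  the shared noise drops out of \<open>x - y\<close>.

  The error per step must be uniform over the \<open>N\<close> steps. It is, because the second
  moments of the first marginals are explicit, the second marginal never changes, and the cost of
  any coupling is bounded by the second moments of its marginals.

  The energy gain L \<gamma> d comes from the quadratic upper bound on \<open>U\<close> and the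
  second moment 2 t d of the noise. The energy bound of the final time is used on all of
  [0, \<gamma>]; this yields 2 \<gamma> (L \<gamma> d), the additive term of the theorem.\<close>

lemma has_bochner_integral_lborel_prod:
  fixes f :: "'a::euclidean_space \<Rightarrow> real \<Rightarrow> real"
  assumes "\<And>b. b \<in> Basis \<Longrightarrow> has_bochner_integral lborel (f b) (I b)"
  shows "has_bochner_integral lborel (\<lambda>z::'a. \<Prod>b\<in>Basis. f b (z \<bullet> b)) (\<Prod>b\<in>Basis. I b)"
proof -
  interpret product_sigma_finite "\<lambda>b::'a. lborel :: real measure" ..
  have int: "integrable lborel (f b)" and I: "integral\<^sup>L lborel (f b) = I b" if "b \<in> Basis" for b
    using assms[OF that] by (auto simp: has_bochner_integral_iff)
  have [measurable]: "f b \<in> borel_measurable borel" if "b \<in> Basis" for b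
    using int[OF that] by auto
  have "has_bochner_integral (\<Pi>\<^sub>M b\<in>Basis. lborel) (\<lambda>x. \<Prod>b\<in>Basis. f b (x b)) (\<Prod>b\<in>Basis. I b)"
    using product_integrable_prod[of Basis f] product_integral_prod[of Basis f] int I
    by (auto simp: has_bochner_integral_iff)
  then show ?thesis
    by (subst lborel_eq, intro has_bochner_integral_distr)
       (auto simp: inner_sum_left inner_Basis if_distrib cong: if_cong)
qed

text \<open>The centred Gaussian with variance 2 t in each coordinate, that is, the law of sqrt(2 t)
  G. With this time scale the noise of a step of size \<gamma> is the heat flow at time exactly
  \<gamma>.\<close>

definition heat_density :: "real \<Rightarrow> 'a::euclidean_space \<Rightarrow> real" where
  "heat_density t z = (4 * pi * t) powr (- real DIM('a) / 2) * exp (- (norm z)\<^sup>2 / (4 * t))"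

definition heat_kernel :: "real \<Rightarrow> 'a::euclidean_space measure" where
  "heat_kernel t = density lborel (\<lambda>z. ennreal (heat_density t z))"

lemma heat_density_nonneg [simp]: "0 \<le> heat_density t z"
  by (simp add: heat_density_def)

lemma heat_density_uminus [simp]: "heat_density t (- z) = heat_density t z"
  by (simp add: heat_density_def)

lemma heat_density_commute: "heat_density t (x - y) = heat_density t (y - x)"
  by (simp add: heat_density_def norm_minus_commute)

lemma measurable_heat_density [measurable]: "heat_density t \<in> borel_measurable borel"
  unfolding heat_density_def[abs_def] by measurable

lemma sets_heat_kernel [simp, measurable_cong]: "sets (heat_kernel t) = sets borel"
  by (simp add: heat_kernel_def)

lemma space_heat_kernel [simp]: "space (heat_kernel t) = UNIV"
  by (simp add: heat_kernel_def)

lemma power_le_fact_exp: "y ^ k \<le> fact k * exp y" if "0 \<le> y" for y :: real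
proof -
  have "(\<Sum>n\<in>{k}. inverse (fact n) *\<^sub>R y ^ n) \<le> exp y"
    unfolding exp_def using that by (intro sum_le_suminf summable_exp_generic) auto
  then show ?thesis by (simp add: field_simps)
qed

lemma lborel_distr_uminus_euclidean: "distr lborel borel uminus = (lborel :: 'a::euclidean_space measure)"
  by (subst lborel_affine[of "-1" 0]) (auto simp: density_1 one_ennreal_def[symmetric])

lemma norm_sq_eq_sum_Basis: "(norm z)\<^sup>2 = (\<Sum>b\<in>Basis. (z \<bullet> b)\<^sup>2)"
  for z :: "'a::euclidean_space"
  unfolding power2_norm_eq_inner by (subst euclidean_inner) (simp add: power2_eq_square)

lemma heat_density_eq_prod:
  fixes z :: "'a::euclidean_space"
  assumes "t > 0"
  shows "heat_density t z = (\<Prod>b\<in>Basis. normal_density 0 (sqrt (2 * t)) (z \<bullet> b))"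
proof -
  have "1 / sqrt (4 * pi * t) = (4 * pi * t) powr (- 1 / 2)"
    using assms by (simp add: powr_minus powr_half_sqrt[symmetric] field_simps)
  moreover have "((4 * pi * t) powr (- 1 / 2)) ^ DIM('a) = (4 * pi * t) powr (- real DIM('a) / 2)"
    using assms by (simp add: powr_realpow[symmetric] powr_powr)
  moreover have "exp (- (norm z)\<^sup>2 / (4 * t)) = (\<Prod>b\<in>Basis. exp (- (z \<bullet> b)\<^sup>2 / (4 * t)))"
    by (subst exp_sum[symmetric]) (simp_all add: norm_sq_eq_sum_Basis sum_negf sum_divide_distrib)
  ultimately show ?thesis
    using assms unfolding heat_density_def normal_density_def prod.distrib
    by (simp add: mult.commute mult.left_commute power_one_over)
qed

context
  fixes t :: real
  assumes t: "t > 0"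
begin

lemma has_bochner_integral_heat_density:
  "has_bochner_integral lborel (heat_density t :: 'a::euclidean_space \<Rightarrow> real) 1"
proof -
  have "has_bochner_integral lborel (normal_density 0 (sqrt (2 * t))) 1"
    using t by (simp add: has_bochner_integral_iff)
  from has_bochner_integral_lborel_prod[of "\<lambda>_. normal_density 0 (sqrt (2 * t))" "\<lambda>_. 1", OF this]
  show ?thesis
    using heat_density_eq_prod[OF t, where 'a='a] by (simp add: fun_eq_iff[symmetric] cong: has_bochner_integral_cong)
qed

lemma prob_space_heat_kernel: "prob_space (heat_kernel t :: 'a::euclidean_space measure)"
  using has_bochner_integral_heat_density[where 'a='a]
  by (intro prob_spaceI)
     (simp add: heat_kernel_def emeasure_density nn_integral_eq_integral has_bochner_integral_iff)

lemma nn_integral_heat_density_shift: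
  "(\<integral>\<^sup>+z. ennreal (heat_density t (z - c)) \<partial>lborel) = 1" for c :: "'a::euclidean_space"
proof -
  have "(\<integral>\<^sup>+z. ennreal (heat_density t (z - c)) \<partial>lborel) = (\<integral>\<^sup>+(z::'a). ennreal (heat_density t z) \<partial>lborel)"
    using nn_integral_distr[of "(+) c" lborel borel "\<lambda>z. ennreal (heat_density t (z - c))"]
    by (simp add: lborel_distr_plus)
  also have "\<dots> = 1"
    using has_bochner_integral_heat_density[where 'a='a]
    by (simp add: nn_integral_eq_integral has_bochner_integral_iff)
  finally show ?thesis .
qed

lemma has_bochner_integral_heat_kernel_iff:
  fixes f :: "'a::euclidean_space \<Rightarrow> real"
  assumes "f \<in> borel_measurable borel"
  shows "has_bochner_integral (heat_kernel t) f I \<longleftrightarrow>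
    has_bochner_integral lborel (\<lambda>z. heat_density t z * f z) I"
  using assms unfolding heat_kernel_def has_bochner_integral_iff
  by (simp add: integrable_density integral_density)

lemma heat_kernel_covariance_Basis:
  fixes b c :: "'a::euclidean_space"
  assumes bc: "b \<in> Basis" "c \<in> Basis"
  shows "has_bochner_integral (heat_kernel t) (\<lambda>z. (z \<bullet> b) * (z \<bullet> c)) (2 * t * (b \<bullet> c))"
proof -
  let ?n = "normal_density 0 (sqrt (2 * t))"
  \<comment> \<open>The factor at \<open>i\<close> receives \<open>x\<close> once for
    \<open>i = b\<close> and once for \<open>i = c\<close>. Hence \<open>b = c\<close> produces a
    second moment, and \<open>b \<noteq> c\<close> produces two first moments, which vanish.\<close>
  define f :: "'a \<Rightarrow> real \<Rightarrow> real" where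
    "f i x = ?n x * ((if i = b then x else 1) * (if i = c then x else 1))" for i x
  define I :: "'a \<Rightarrow> real" where
    "I i = (if i = b \<and> i = c then 2 * t else if i = b \<or> i = c then 0 else 1)" for i
  have "has_bochner_integral lborel (f i) (I i)" if "i \<in> Basis" for i
    using normal_moment_even[of "sqrt (2 * t)" 0 1] normal_moment_odd[of "sqrt (2 * t)" 0 0]
      normal_moment_even[of "sqrt (2 * t)" 0 0] t
    by (auto simp: f_def[abs_def] I_def power2_eq_square fact_numeral)
  from has_bochner_integral_lborel_prod[of f I, OF this]
  have "has_bochner_integral lborel (\<lambda>z. \<Prod>i\<in>Basis. f i (z \<bullet> i)) (\<Prod>i\<in>Basis. I i)" by simp
  moreover have "(\<Prod>i\<in>Basis. f i (z \<bullet> i)) = heat_density t z * ((z \<bullet> b) * (z \<bullet> c))" for z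
    using bc by (simp add: f_def prod.distrib heat_density_eq_prod[OF t])
  moreover have "(\<Prod>i\<in>Basis. I i) = 2 * t * (b \<bullet> c)"
  proof (cases "b = c")
    case True
    then have "(\<Prod>i\<in>Basis. I i) = (\<Prod>i\<in>Basis. if i = c then 2 * t else 1)"
      by (intro prod.cong) (auto simp: I_def)
    with True bc show ?thesis by simp
  next
    case False
    then have "I b = 0" by (simp add: I_def)
    with bc have "(\<Prod>i\<in>Basis. I i) = 0" by (intro prod_zero) auto
    with False bc show ?thesis by (simp add: inner_not_same_Basis)
  qed
  ultimately show ?thesis
    by (subst has_bochner_integral_heat_kernel_iff) auto
qed

lemma heat_kernel_covariance:
  fixes u v :: "'a::euclidean_space"
  shows "has_bochner_integral (heat_kernel t) (\<lambda>z. (u \<bullet> z) * (v \<bullet> z)) (2 * t * (u \<bullet> v))"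
proof -
  have "has_bochner_integral (heat_kernel t)
      (\<lambda>z::'a. \<Sum>b\<in>Basis. \<Sum>c\<in>Basis. (u \<bullet> b) * (v \<bullet> c) * ((z \<bullet> b) * (z \<bullet> c)))
      (\<Sum>b\<in>Basis. \<Sum>c\<in>Basis. (u \<bullet> b) * (v \<bullet> c) * (2 * t * (b \<bullet> c)))"
    by (intro has_bochner_integral_sum has_bochner_integral_mult_right heat_kernel_covariance_Basis) auto
  moreover have "(\<Sum>b\<in>Basis. \<Sum>c\<in>Basis. (u \<bullet> b) * (v \<bullet> c) * ((z \<bullet> b) * (z \<bullet> c))) = (u \<bullet> z) * (v \<bullet> z)"
    for z :: 'a
    by (simp add: euclidean_inner[of u z] euclidean_inner[of v z] sum_product mult_ac)
  moreover have "(\<Sum>b\<in>Basis. \<Sum>c\<in>Basis. (u \<bullet> b) * (v \<bullet> c) * (2 * t * (b \<bullet> c))) = 2 * t * (u \<bullet> v)"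
  proof -
    have "(\<Sum>c\<in>Basis. (u \<bullet> b) * (v \<bullet> c) * (2 * t * (b \<bullet> c))) = 2 * t * ((u \<bullet> b) * (v \<bullet> b))"
      if "b \<in> Basis" for b
      using that by (subst sum.cong[OF refl, where h="\<lambda>c. if c = b then 2 * t * ((u \<bullet> b) * (v \<bullet> b)) else 0"])
        (auto simp: inner_Basis)
    then show ?thesis by (simp add: euclidean_inner[of u v] sum_distrib_left)
  qed
  ultimately show ?thesis by simp
qed

lemma heat_kernel_second_moment:
  "has_bochner_integral (heat_kernel t) (\<lambda>z::'a::euclidean_space. (norm z)\<^sup>2) (2 * t * DIM('a))"
proof -
  have "has_bochner_integral (heat_kernel t) (\<lambda>z::'a. \<Sum>b\<in>Basis. (b \<bullet> z) * (b \<bullet> z))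
     (\<Sum>b\<in>(Basis::'a set). 2 * t * (b \<bullet> b))"
    by (intro has_bochner_integral_sum heat_kernel_covariance)
  then show ?thesis
    unfolding norm_sq_eq_sum_Basis by (simp add: power2_eq_square inner_commute mult_ac)
qed

text \<open>Reflection symmetry of the Gaussian. An odd integrand is thereby shown to have an
  integral equal to its own negative, hence 0.\<close>

lemma has_bochner_integral_heat_kernel_uminus:
  fixes f :: "'a::euclidean_space \<Rightarrow> real"
  assumes "has_bochner_integral (heat_kernel t) f I"
  shows "has_bochner_integral (heat_kernel t) (\<lambda>z. f (- z)) I"
proof -
  have [measurable]: "f \<in> borel_measurable borel"
    using assms by (auto simp: has_bochner_integral_iff)
  have "has_bochner_integral (distr lborel borel uminus) (\<lambda>z. heat_density t z * f z) I"
    using assms by (simp add: has_bochner_integral_heat_kernel_iff lborel_distr_uminus_euclidean)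
  then have "has_bochner_integral lborel (\<lambda>z. heat_density t z * f (- z)) I"
    by (simp add: has_bochner_integral_iff integrable_distr_eq integral_distr)
  then show ?thesis
    by (simp add: has_bochner_integral_heat_kernel_iff)
qed

end

context
  fixes t :: real
  assumes t: "t > 0"
begin

text \<open>Half of the Gaussian exponent absorbs the polynomial: \<open>power_le_fact_exp\<close>
  at \<open>(norm z)\<^sup>2 / (8 * t)\<close> leaves the density at time \<open>2 * t\<close>, and
  the two normalizing factors differ by \<open>2 powr (DIM('a) / 2)\<close>. Only the scaling in
  \<open>t\<close> matters later.\<close>

lemma heat_kernel_even_moment:
  "integrable (heat_kernel t) (\<lambda>z::'a::euclidean_space. norm z ^ (2 * k))" (is ?I)
  "(\<integral>(z::'a). norm z ^ (2 * k) \<partial>heat_kernel t) \<le> (8 * t) ^ k * fact k * 2 powr (DIM('a) / 2)" (is ?B)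
proof -
  let ?c = "(8 * t) ^ k * fact k * 2 powr (DIM('a) / 2)"
  have le: "heat_density t z * norm z ^ (2 * k) \<le> ?c * heat_density (2 * t) z" for z :: 'a
  proof -
    have "((norm z)\<^sup>2 / (8 * t)) ^ k \<le> fact k * exp ((norm z)\<^sup>2 / (8 * t))"
      using t by (intro power_le_fact_exp) auto
    then have "norm z ^ (2 * k) \<le> (8 * t) ^ k * fact k * exp ((norm z)\<^sup>2 / (8 * t))"
      using t by (simp add: power_divide power_mult_distrib pos_divide_le_eq mult_ac flip: power_mult)
    then have "heat_density t z * norm z ^ (2 * k)
        \<le> heat_density t z * ((8 * t) ^ k * fact k * exp ((norm z)\<^sup>2 / (8 * t)))"
      by (rule mult_left_mono) simp
    also have "heat_density t z * exp ((norm z)\<^sup>2 / (8 * t)) = 2 powr (DIM('a) / 2) * heat_density (2 * t) z"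
    proof -
      have "exp (- (norm z)\<^sup>2 / (4 * t)) * exp ((norm z)\<^sup>2 / (8 * t)) = exp (- (norm z)\<^sup>2 / (4 * (2 * t)))"
        using t by (simp add: exp_add[symmetric] field_simps)
      moreover have "(4 * pi * (2 * t)) powr (- real DIM('a) / 2) =
          2 powr (- real DIM('a) / 2) * (4 * pi * t) powr (- real DIM('a) / 2)"
        using t by (subst powr_mult[symmetric]) (auto simp: mult_ac)
      moreover have "2 powr (real DIM('a) / 2) * 2 powr (- real DIM('a) / 2) = 1"
        by (simp add: powr_add[symmetric])
      ultimately show ?thesis
        by (simp add: heat_density_def mult.assoc mult.left_commute)
    qed
    then have "heat_density t z * ((8 * t) ^ k * fact k * exp ((norm z)\<^sup>2 / (8 * t))) = ?c * heat_density (2 * t) z"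
      by (simp add: mult_ac)
    finally show ?thesis by (simp add: mult_ac)
  qed
  have h: "has_bochner_integral lborel (\<lambda>z::'a. ?c * heat_density (2 * t) z) (?c * 1)"
    using t by (intro has_bochner_integral_mult_right has_bochner_integral_heat_density) auto
  have int: "integrable lborel (\<lambda>z::'a. heat_density t z * norm z ^ (2 * k))"
    using h le by (intro Bochner_Integration.integrable_bound[OF integrable.intros[OF h]])
      (auto intro: order_trans[OF _ abs_ge_self])
  then show ?I
    by (simp add: heat_kernel_def integrable_density)
  have "(\<integral>(z::'a). heat_density t z * norm z ^ (2 * k) \<partial>lborel) \<le> (\<integral>(z::'a). ?c * heat_density (2 * t) z \<partial>lborel)"
    using h le int by (intro integral_mono) (auto simp: has_bochner_integral_iff)
  then show ?B
    using h t by (simp add: heat_kernel_def integral_density has_bochner_integral_iff)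
qed

text \<open>Odd powers are reduced to even ones by a \<le> s + a^2 / s. The choice
  \<open>s = sqrt t ^ k\<close> gives both summands the same order in \<open>t\<close>.\<close>

lemma heat_kernel_moment:
  "integrable (heat_kernel t) (\<lambda>z::'a::euclidean_space. norm z ^ k)" (is ?I)
  "(\<integral>(z::'a). norm z ^ k \<partial>heat_kernel t) \<le> (1 + 8 ^ k * fact k * 2 powr (DIM('a) / 2)) * sqrt t ^ k" (is ?B)
proof -
  interpret prob_space "heat_kernel t :: 'a measure" by (rule prob_space_heat_kernel[OF t])
  let ?g = "\<lambda>z::'a. sqrt t ^ k + norm z ^ (2 * k) / sqrt t ^ k"
  have le: "norm z ^ k \<le> ?g z" for z :: 'a
  proof -
    have "0 < sqrt t ^ k" using t by simp
    moreover have "a \<le> s + a\<^sup>2 / s" if "s > 0" "a \<ge> 0" for a s :: real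
    proof (cases "a \<le> s")
      case False
      then have "a * s \<le> a * a" using that by (intro mult_left_mono) auto
      then show ?thesis using that by (simp add: field_simps power2_eq_square add_increasing2)
    qed (use that in \<open>simp add: add_increasing2\<close>)
    ultimately show ?thesis
      by (metis norm_ge_zero power_mult mult.commute zero_le_power)
  qed
  have g: "integrable (heat_kernel t) ?g"
    using heat_kernel_even_moment(1)[of k, where 'a='a] by simp
  show ?I
    by (rule Bochner_Integration.integrable_bound[OF g]) (use le in \<open>auto intro: order_trans[OF _ abs_ge_self]\<close>)
  have "(\<integral>(z::'a). norm z ^ k \<partial>heat_kernel t) \<le> integral\<^sup>L (heat_kernel t) ?g"
    using g le \<open>?I\<close> by (intro integral_mono) auto
  also have "\<dots> = sqrt t ^ k + (\<integral>(z::'a). norm z ^ (2 * k) \<partial>heat_kernel t) / sqrt t ^ k"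
    using heat_kernel_even_moment(1)[of k, where 'a='a] prob_space by simp
  also have "\<dots> \<le> sqrt t ^ k + ((8 * t) ^ k * fact k * 2 powr (DIM('a) / 2)) / sqrt t ^ k"
    using heat_kernel_even_moment(2)[of k, where 'a='a] t by (intro add_left_mono divide_right_mono) auto
  also have "(8 * t) ^ k = 8 ^ k * (sqrt t ^ k * sqrt t ^ k)"
    using t by (metis power_mult_distrib real_sqrt_mult_self abs_of_pos)
  also have "sqrt t ^ k + (8 ^ k * (sqrt t ^ k * sqrt t ^ k) * fact k * 2 powr (DIM('a) / 2)) / sqrt t ^ k
      = (1 + 8 ^ k * fact k * 2 powr (DIM('a) / 2)) * sqrt t ^ k"
  proof -
    have "sqrt t ^ k > 0" using t by simp
    then show ?thesis by (simp add: distrib_right)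
  qed
  finally show ?B .
qed

lemma heat_kernel_mean:
  "has_bochner_integral (heat_kernel t) (\<lambda>z. u \<bullet> z) 0" for u :: "'a::euclidean_space"
proof -
  have "integrable (heat_kernel t) (\<lambda>z::'a. norm u * norm z)"
    using heat_kernel_moment(1)[of 1, where 'a='a] by simp
  then have "integrable (heat_kernel t) (\<lambda>z. u \<bullet> z)"
    by (rule Bochner_Integration.integrable_bound) (auto simp: Cauchy_Schwarz_ineq2)
  then have h: "has_bochner_integral (heat_kernel t) (\<lambda>z. u \<bullet> z) (\<integral>z. u \<bullet> z \<partial>heat_kernel t)"
    by (simp add: has_bochner_integral_iff)
  then have "has_bochner_integral (heat_kernel t) (\<lambda>z. - (u \<bullet> z)) (\<integral>z. u \<bullet> z \<partial>heat_kernel t)"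
    using has_bochner_integral_heat_kernel_uminus[OF t] by fastforce
  with h have "(\<integral>z. u \<bullet> z \<partial>heat_kernel t) = - (\<integral>z. u \<bullet> z \<partial>heat_kernel t)"
    by (simp add: has_bochner_integral_iff)
  with h show ?thesis by simp
qed

end

lemma integrable_norm_power_exp:
  assumes "c > 0"
  shows "integrable lborel (\<lambda>x::'a::euclidean_space. norm x ^ k * exp (- c * (norm x)\<^sup>2))"
proof -
  let ?t = "1 / (4 * c)"
  have "integrable lborel (\<lambda>z::'a. heat_density ?t z * norm z ^ k)"
    using heat_kernel_moment(1)[of ?t k, where 'a='a] assms
    by (simp add: heat_kernel_def integrable_density)
  then have "integrable lborel (\<lambda>z::'a. heat_density ?t z * norm z ^ k / (4 * pi * ?t) powr (- real DIM('a) / 2))"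
    by (rule integrable_divide)
  moreover have "(4 * pi * ?t) powr (- real DIM('a) / 2) \<noteq> 0"
    using assms by simp
  ultimately show ?thesis
    using assms by (simp add: heat_density_def field_simps)
qed

text \<open>Completing the square in \<open>z\<close>: the product is a Gaussian in \<open>y\<close>
  alone times a shifted Gaussian in \<open>z\<close>. Integrating over \<open>z\<close> then removes
  the second factor, which yields the convolution formula.\<close>

lemma heat_density_mult:
  fixes y z :: "'a::euclidean_space"
  assumes "s > 0" "t > 0"
  shows "heat_density s (y - z) * heat_density t z =
    heat_density (s + t) y * heat_density (s * t / (s + t)) (z - (t / (s + t)) *\<^sub>R y)"
proof -
  have "(4 * pi * s) powr a * (4 * pi * t) powr a =
      (4 * pi * (s + t)) powr a * (4 * pi * (s * t / (s + t))) powr a" for a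
  proof -
    have "(4 * pi * s) * (4 * pi * t) = (4 * pi * (s + t)) * (4 * pi * (s * t / (s + t)))"
      using assms by simp
    then show ?thesis by (metis powr_mult)
  qed
  moreover have "- (norm (y - z))\<^sup>2 / (4 * s) + - (norm z)\<^sup>2 / (4 * t) =
    - (norm y)\<^sup>2 / (4 * (s + t)) + - (norm (z - (t / (s + t)) *\<^sub>R y))\<^sup>2 / (4 * (s * t / (s + t)))"
  proof -
    \<comment> \<open>In the three inner products the claim on the exponents becomes a rational
      identity between real numbers.\<close>
    define A B C where "A = y \<bullet> y" and "B = y \<bullet> z" and "C = z \<bullet> z"
    have 1: "(norm (y - z))\<^sup>2 = A - 2 * B + C"
      by (simp add: power2_norm_eq_inner A_def B_def C_def inner_commute algebra_simps)
    have 2: "(norm (z - r *\<^sub>R y))\<^sup>2 = C - 2 * r * B + r\<^sup>2 * A" for r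
      unfolding power2_norm_eq_inner
      by (simp add: A_def B_def C_def inner_commute algebra_simps power2_eq_square)
    have 3: "(norm y)\<^sup>2 = A" and 4: "(norm z)\<^sup>2 = C"
      by (simp_all add: A_def C_def power2_norm_eq_inner)
    have "- (A - 2 * B + C) / (4 * s) + - C / (4 * t) =
      - A / (4 * (s + t)) + - (C - 2 * (t / (s + t)) * B + (t / (s + t))\<^sup>2 * A) / (4 * (s * t / (s + t)))"
    proof -
      have n: "s \<noteq> 0" "t \<noteq> 0" "s + t \<noteq> 0" using assms by auto
      have "(C - 2 * (t / (s + t)) * B + (t / (s + t))\<^sup>2 * A) / (4 * (s * t / (s + t))) = C * (s + t) / (4 * s * t) - B / (2 * s) + A * t / (4 * s * (s + t))"
      proof -
        have "(C - 2 * (t / r) * B + (t / r)\<^sup>2 * A) / (4 * (s * t / r)) = C * r / (4 * s * t) - B / (2 * s) + A * t / (4 * s * r)" if "r \<noteq> 0" for r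
          using n that by (simp add: field_simps power2_eq_square)
        with n show ?thesis by blast
      qed
      moreover have "A / (4 * (s + t)) + A * t / (4 * s * (s + t)) = A / (4 * s)" using n by (simp add: divide_simps) (simp add: algebra_simps)
      moreover have "C * (s + t) / (4 * s * t) = C / (4 * s) + C / (4 * t)" using n by (simp add: divide_simps) (simp add: algebra_simps)
      moreover have "(A - 2 * B + C) / (4 * s) = A / (4 * s) - B / (2 * s) + C / (4 * s)"
        by (simp add: add_divide_distrib diff_divide_distrib)
      ultimately show ?thesis
        unfolding minus_divide_left[symmetric] by linarith
    qed
    then show ?thesis
      unfolding 1 2 3 4 .
  qed
  then have "exp (- (norm (y - z))\<^sup>2 / (4 * s)) * exp (- (norm z)\<^sup>2 / (4 * t)) =
    exp (- (norm y)\<^sup>2 / (4 * (s + t))) * exp (- (norm (z - (t / (s + t)) *\<^sub>R y))\<^sup>2 / (4 * (s * t / (s + t))))"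
    by (simp only: exp_add[symmetric])
  moreover have mult_cross: "p1 * e1 * (p2 * e2) = q1 * f1 * (q2 * f2)"
    if "p1 * p2 = q1 * q2" "e1 * e2 = f1 * f2" for p1 p2 q1 q2 e1 e2 f1 f2 :: real
  proof -
    have "p1 * e1 * (p2 * e2) = (p1 * p2) * (e1 * e2)" by (simp only: mult_ac)
    also have "\<dots> = q1 * f1 * (q2 * f2)" unfolding that by (simp only: mult_ac)
    finally show ?thesis .
  qed
  ultimately show ?thesis
    unfolding heat_density_def by (intro mult_cross) assumption+
qed

lemma heat_density_convolution:
  fixes y :: "'a::euclidean_space"
  assumes "s > 0" "t > 0"
  shows "(\<integral>\<^sup>+z. ennreal (heat_density s (y - z)) * ennreal (heat_density t z) \<partial>lborel) = ennreal (heat_density (s + t) y)"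
  using assms by (simp add: ennreal_mult'[symmetric] heat_density_mult)
    (simp add: ennreal_mult' nn_integral_cmult nn_integral_heat_density_shift)

section \<open>The heat flow and its semigroup property\<close>

definition heat_flow :: "real \<Rightarrow> 'a::euclidean_space measure \<Rightarrow> 'a measure" where
  "heat_flow t \<nu> = distr (\<nu> \<Otimes>\<^sub>M heat_kernel t) borel (\<lambda>(x, z). x + z)"

lemma sets_heat_flow [simp, measurable_cong]: "sets (heat_flow t \<nu>) = sets borel"
  by (simp add: heat_flow_def)

lemma prob_space_heat_flow:
  assumes "prob_space \<nu>" "sets \<nu> = sets borel" "t > 0"
  shows "prob_space (heat_flow t \<nu>)"
proof -
  interpret prob_space \<nu> by fact
  interpret K: prob_space "heat_kernel t :: 'a measure" using assms by (intro prob_space_heat_kernel)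
  interpret pair_prob_space \<nu> "heat_kernel t :: 'a measure" ..
  note assms(2)[measurable_cong]
  show ?thesis unfolding heat_flow_def by (intro P.prob_space_distr) measurable
qed

lemma nn_integral_heat_flow:
  assumes "sets \<nu> = sets borel" "t > 0" and [measurable]: "f \<in> borel_measurable borel"
  shows "(\<integral>\<^sup>+x. f x \<partial>heat_flow t \<nu>) = (\<integral>\<^sup>+x. \<integral>\<^sup>+z. f (x + z) \<partial>heat_kernel t \<partial>\<nu>)"
proof -
  note assms(1)[measurable_cong]
  interpret K: prob_space "heat_kernel t :: 'a measure" using assms by (intro prob_space_heat_kernel)
  show ?thesis
    by (simp add: heat_flow_def nn_integral_distr K.nn_integral_fst[symmetric] split_beta')
qed

lemma measure_eqI_nn_integral:
  assumes "sets M = sets borel" "sets N = sets borel"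
    and "\<And>f. f \<in> borel_measurable borel \<Longrightarrow> (\<integral>\<^sup>+x. f x \<partial>M) = (\<integral>\<^sup>+x. f x \<partial>N)"
  shows "M = N"
proof (rule measure_eqI)
  fix A assume "A \<in> sets M"
  then show "emeasure M A = emeasure N A"
    using assms(3)[of "indicator A"] assms(1,2) by simp
qed (simp add: assms)

text \<open>The semigroup property makes the subdivision of the time interval exact on the first
  marginal: many short flows compose to the full Gaussian noise without any discretization
  error.\<close>

lemma heat_flow_heat_flow:
  assumes \<nu>: "sets \<nu> = sets (borel :: 'a::euclidean_space measure)" and st: "s > 0" "t > 0"
  shows "heat_flow s (heat_flow t \<nu>) = heat_flow (s + t) \<nu>"
proof (rule measure_eqI_nn_integral)
  fix f :: "'a \<Rightarrow> ennreal" assume f [measurable]: "f \<in> borel_measurable borel"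
  note \<nu>[measurable_cong]
  have "(\<integral>\<^sup>+z. \<integral>\<^sup>+z'. f (x + z + z') \<partial>heat_kernel s \<partial>heat_kernel t) = (\<integral>\<^sup>+z. f (x + z) \<partial>heat_kernel (s + t))" for x
  proof -
    have "(\<integral>\<^sup>+z. \<integral>\<^sup>+z'. f (x + z + z') \<partial>heat_kernel s \<partial>heat_kernel t) =
      (\<integral>\<^sup>+z. (\<integral>\<^sup>+z'. ennreal (heat_density t z) * (ennreal (heat_density s z') * f (x + z + z')) \<partial>lborel) \<partial>lborel)"
      by (simp add: heat_kernel_def nn_integral_density nn_integral_cmult)
    also have "\<dots> = (\<integral>\<^sup>+z. (\<integral>\<^sup>+y. ennreal (heat_density t z) * (ennreal (heat_density s (y - z)) * f (x + y)) \<partial>lborel) \<partial>lborel)"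
    proof (rule nn_integral_cong)
      fix z :: 'a
      show "(\<integral>\<^sup>+z'. ennreal (heat_density t z) * (ennreal (heat_density s z') * f (x + z + z')) \<partial>lborel) =
        (\<integral>\<^sup>+y. ennreal (heat_density t z) * (ennreal (heat_density s (y - z)) * f (x + y)) \<partial>lborel)"
        using nn_integral_distr[of "(+) z" lborel borel
          "\<lambda>y. ennreal (heat_density t z) * (ennreal (heat_density s (y - z)) * f (x + y))"]
        by (simp add: lborel_distr_plus add.assoc)
    qed
    also have "\<dots> = (\<integral>\<^sup>+y. (\<integral>\<^sup>+z. f (x + y) * (ennreal (heat_density s (y - z)) * ennreal (heat_density t z)) \<partial>lborel) \<partial>lborel)"
      by (subst lborel_pair.Fubini') (auto simp: mult_ac)
    also have "\<dots> = (\<integral>\<^sup>+y. f (x + y) * ennreal (heat_density (s + t) y) \<partial>lborel)"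
      by (simp add: nn_integral_cmult heat_density_convolution[OF st])
    also have "\<dots> = (\<integral>\<^sup>+z. f (x + z) \<partial>heat_kernel (s + t))"
      by (simp add: heat_kernel_def nn_integral_density mult.commute)
    finally show ?thesis .
  qed
  moreover have "(\<lambda>x. \<integral>\<^sup>+z. f (x + z) \<partial>heat_kernel s) \<in> borel_measurable borel"
  proof -
    interpret K: prob_space "heat_kernel s :: 'a measure" using st by (intro prob_space_heat_kernel)
    show ?thesis by measurable
  qed
  ultimately show "(\<integral>\<^sup>+x. f x \<partial>heat_flow s (heat_flow t \<nu>)) = (\<integral>\<^sup>+x. f x \<partial>heat_flow (s + t) \<nu>)"
    using st by (simp add: nn_integral_heat_flow \<nu>)
qed simp_all

section \<open>Strongly convex potentials and their Gibbs measures\<close>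

locale strongly_convex_potential =
  fixes U :: "'a::euclidean_space \<Rightarrow> real" and gradU :: "'a \<Rightarrow> 'a" and m L :: real
  assumes m_pos: "m > 0"
    and convex: "m_convex m U"
    and gradient: "\<And>x. GDERIV U x :> gradU x"
    and lipschitz: "\<And>x y. norm (gradU x - gradU y) \<le> L * norm (x - y)"
begin

lemma has_real_derivative_line:
  "((\<lambda>t. U (x + t *\<^sub>R h)) has_real_derivative (gradU (x + t *\<^sub>R h) \<bullet> h)) (at t)"
proof -
  have "((\<lambda>t. x + t *\<^sub>R h) has_derivative (\<lambda>s. s *\<^sub>R h)) (at t)"
    by (auto intro!: derivative_eq_intros)
  moreover have "(U has_derivative (\<lambda>h'. h' \<bullet> gradU (x + t *\<^sub>R h))) (at (x + t *\<^sub>R h))"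
    using gradient by (simp add: gderiv_def)
  ultimately have "((\<lambda>t. U (x + t *\<^sub>R h)) has_derivative (\<lambda>s. (s *\<^sub>R h) \<bullet> gradU (x + t *\<^sub>R h))) (at t)"
    by (rule has_derivative_compose)
  moreover have "(\<lambda>s. (s *\<^sub>R h) \<bullet> gradU (x + t *\<^sub>R h)) = (*) (gradU (x + t *\<^sub>R h) \<bullet> h)"
    by (auto simp: fun_eq_iff inner_commute)
  ultimately show ?thesis
    by (simp add: has_field_derivative_def)
qed

text \<open>Convexity on the segment from \<open>x\<close> to \<open>y\<close>, divided by the
  parameter \<open>t\<close>, bounds the difference quotient at \<open>x\<close>. As
  \<open>t\<close> decreases to 0 the quotient tends to the directional derivative and the factor
  \<open>1 - t\<close> to 1.\<close>

lemma gradient_lower_bound: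
  "U x + gradU x \<bullet> (y - x) + m / 2 * (norm (y - x))\<^sup>2 \<le> U y"
proof -
  let ?h = "y - x"
  have "((\<lambda>t. U (x + t *\<^sub>R ?h)) has_real_derivative (gradU x \<bullet> ?h)) (at 0)"
    using has_real_derivative_line[of x ?h 0] by simp
  then have "((\<lambda>t. (U (x + t *\<^sub>R ?h) - U x) / t) \<longlongrightarrow> gradU x \<bullet> ?h) (at_right 0)"
    by (simp add: DERIV_def filterlim_at_split)
  moreover have "((\<lambda>t. U y - U x - (1 - t) * (m / 2) * (norm ?h)\<^sup>2) \<longlongrightarrow>
      U y - U x - (1 - 0) * (m / 2) * (norm ?h)\<^sup>2) (at_right 0)"
    by (intro tendsto_intros)
  moreover have "\<forall>\<^sub>F t in at_right 0. (U (x + t *\<^sub>R ?h) - U x) / t \<le> U y - U x - (1 - t) * (m / 2) * (norm ?h)\<^sup>2"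
    using eventually_at_right_less[of "0::real"] eventually_at_right_real[OF zero_less_one]
  proof eventually_elim
    case (elim t)
    then have "U (t *\<^sub>R y + (1 - t) *\<^sub>R x) \<le> t * U y + (1 - t) * U x - t * (1 - t) * (m / 2) * (norm ?h)\<^sup>2"
      using convex unfolding m_convex_def by auto
    also have "t *\<^sub>R y + (1 - t) *\<^sub>R x = x + t *\<^sub>R ?h"
      by (simp add: algebra_simps)
    finally have "U (x + t *\<^sub>R ?h) - U x \<le> (U y - U x - (1 - t) * (m / 2) * (norm ?h)\<^sup>2) * t"
      by (simp add: algebra_simps)
    then show ?case
      using elim by (simp only: pos_divide_le_eq)
  qed
  ultimately have "gradU x \<bullet> ?h \<le> U y - U x - (1 - 0) * (m / 2) * (norm ?h)\<^sup>2"
    by (intro tendsto_le[OF trivial_limit_at_right_real])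
  then show ?thesis by simp
qed

text \<open>The descent lemma. The difference of the two sides along the segment, \<open>g\<close>,
  has a nonpositive derivative by Cauchy-Schwarz and the Lipschitz bound.\<close>

lemma gradient_upper_bound:
  "U y \<le> U x + gradU x \<bullet> (y - x) + L / 2 * (norm (y - x))\<^sup>2"
proof -
  let ?h = "y - x"
  define g where "g t = U (x + t *\<^sub>R ?h) - t * (gradU x \<bullet> ?h) - L / 2 * t\<^sup>2 * (norm ?h)\<^sup>2" for t
  have "g 1 \<le> g 0"
  proof (rule DERIV_nonpos_imp_nonincreasing[of 0 1])
    fix t :: real assume t: "0 \<le> t"
    let ?D = "gradU (x + t *\<^sub>R ?h) \<bullet> ?h - gradU x \<bullet> ?h - L * t * (norm ?h)\<^sup>2"
    have "(g has_real_derivative ?D) (at t)"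
      unfolding g_def[abs_def] by (auto intro!: derivative_eq_intros has_real_derivative_line)
    moreover have "?D \<le> 0"
    proof -
      have "(gradU (x + t *\<^sub>R ?h) - gradU x) \<bullet> ?h \<le> norm (gradU (x + t *\<^sub>R ?h) - gradU x) * norm ?h"
        by (rule norm_cauchy_schwarz)
      also have "\<dots> \<le> (L * norm ((x + t *\<^sub>R ?h) - x)) * norm ?h"
        by (intro mult_right_mono lipschitz) simp
      finally show ?thesis
        using t by (simp add: inner_diff_left power2_eq_square mult_ac)
    qed
    ultimately show "\<exists>D. (g has_real_derivative D) (at t) \<and> D \<le> 0" by blast
  qed simp
  then show ?thesis by (simp add: g_def)
qed

text \<open>Both quadratic bounds are compared between 0 and a unit vector. Positivity of
  \<open>L\<close> and nonnegativity of the contraction factor rest on this.\<close>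

lemma L_ge_m: "m \<le> L"
proof -
  obtain b :: 'a where "b \<in> Basis" using nonempty_Basis by blast
  with gradient_lower_bound[of 0 b] gradient_upper_bound[of b 0] show ?thesis by simp
qed

lemma L_pos: "0 < L"
  using L_ge_m m_pos by simp

lemma gradient_approximation:
  "\<bar>U y - U x - gradU x \<bullet> (y - x)\<bar> \<le> L / 2 * (norm (y - x))\<^sup>2"
proof -
  have "0 \<le> m / 2 * (norm (y - x))\<^sup>2" "0 \<le> L / 2 * (norm (y - x))\<^sup>2" using m_pos L_pos by auto
  with gradient_lower_bound[of x y] gradient_upper_bound[of y x] show ?thesis by simp
qed

text \<open>Expanding the square leaves a term \<gamma>^2 |grad U(x)|^2. Since \<gamma> L \<le> 1,
  the descent lemma pays for it with the decrease of \<open>U\<close> along the step. So the energy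
  that appears is the one at the new point, which is where the heat flow starts. The cross term
  gives the contraction by strong convexity.\<close>

lemma gradient_step:
  assumes "0 < \<gamma>" "\<gamma> \<le> 1 / L"
  shows "(norm (x - \<gamma> *\<^sub>R gradU x - y))\<^sup>2
    \<le> (1 - m * \<gamma>) * (norm (x - y))\<^sup>2 - 2 * \<gamma> * (U (x - \<gamma> *\<^sub>R gradU x) - U y)"
proof -
  have g: "\<gamma> * L \<le> 1" using assms L_pos by (simp add: field_simps)
  define G where "G = (norm (gradU x))\<^sup>2"
  have "U (x - \<gamma> *\<^sub>R gradU x) \<le> U x - \<gamma> * G + L / 2 * (\<gamma>\<^sup>2 * G)"
    using gradient_upper_bound[of "x - \<gamma> *\<^sub>R gradU x" x]
    by (simp add: G_def dot_square_norm power_mult_distrib)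
  moreover have "(\<gamma> * L) * (\<gamma> * G) \<le> 1 * (\<gamma> * G)"
    using g assms by (intro mult_right_mono) (auto simp: G_def)
  ultimately have "2 * (U (x - \<gamma> *\<^sub>R gradU x) - U x) \<le> - \<gamma> * G"
    by (simp add: power2_eq_square algebra_simps)
  then have 1: "\<gamma> * (2 * (U (x - \<gamma> *\<^sub>R gradU x) - U x)) \<le> \<gamma> * (- \<gamma> * G)"
    using assms by (intro mult_left_mono) auto
  have "\<gamma> * (U x - U y + m / 2 * (norm (x - y))\<^sup>2) \<le> \<gamma> * (gradU x \<bullet> (x - y))"
    using assms gradient_lower_bound[of x y]
    by (intro mult_left_mono) (auto simp: norm_minus_commute inner_diff_right)
  moreover have "(norm (x - \<gamma> *\<^sub>R gradU x - y))\<^sup>2 = (norm (x - y))\<^sup>2 - 2 * \<gamma> * (gradU x \<bullet> (x - y)) + \<gamma>\<^sup>2 * G"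
    unfolding G_def power2_norm_eq_inner
    by (simp add: inner_commute algebra_simps power2_eq_square)
  ultimately show ?thesis
    using 1 by (simp add: algebra_simps power2_eq_square)
qed

section \<open>Measurability, growth bounds and the Gibbs measure\<close>

lemma continuous_on_gradU: "continuous_on UNIV gradU"
proof (rule lipschitz_on_continuous_on)
qed (rule lipschitz_onI, use lipschitz L_pos in \<open>auto simp: dist_norm\<close>)

lemma measurable_gradU [measurable]: "gradU \<in> borel_measurable borel"
  using continuous_on_gradU by (rule borel_measurable_continuous_onI)

lemma measurable_U [measurable]: "U \<in> borel_measurable borel"
proof (rule borel_measurable_continuous_onI)
  show "continuous_on UNIV U"
    using gradient unfolding gderiv_def
    by (meson continuous_at_imp_continuous_on has_derivative_continuous)
qed

lemma norm_gradU_le: "norm (gradU x) \<le> norm (gradU 0) + L * norm x"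
  using lipschitz[of x 0] norm_triangle_sub[of "gradU x" "gradU 0"] by simp

text \<open>Quadratic growth, which makes \<open>U\<close> integrable against every measure in
  \<open>P2\<close>. The linear term is absorbed by r \<le> 1 + r^2.\<close>

lemma abs_U_le: "\<bar>U x\<bar> \<le> \<bar>U 0\<bar> + norm (gradU 0) + (norm (gradU 0) + L) * (norm x)\<^sup>2"
proof -
  have "\<bar>U x\<bar> \<le> \<bar>U 0\<bar> + \<bar>gradU 0 \<bullet> x\<bar> + L / 2 * (norm x)\<^sup>2"
    using gradient_approximation[of x 0] by (simp only: diff_zero)
  also have "\<bar>gradU 0 \<bullet> x\<bar> \<le> norm (gradU 0) * norm x"
    by (rule Cauchy_Schwarz_ineq2)
  also have "\<dots> \<le> norm (gradU 0) * (1 + (norm x)\<^sup>2)"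
  proof (intro mult_left_mono)
    have "0 \<le> (norm x - 1 / 2)\<^sup>2" by simp
    then show "norm x \<le> 1 + (norm x)\<^sup>2" unfolding power2_diff by (simp add: field_simps power2_eq_square)
  qed simp
  finally have "\<bar>U x\<bar> \<le> \<bar>U 0\<bar> + norm (gradU 0) * (1 + (norm x)\<^sup>2) + L / 2 * (norm x)\<^sup>2" by simp
  moreover have "L / 2 * (norm x)\<^sup>2 \<le> L * (norm x)\<^sup>2" using L_pos by (intro mult_right_mono) auto
  ultimately show ?thesis by (simp add: algebra_simps)
qed

lemma integrable_U:
  assumes "finite_measure \<mu>" and [measurable_cong]: "sets \<mu> = sets borel"
    and "integrable \<mu> (\<lambda>x. (norm x)\<^sup>2)"
  shows "integrable \<mu> U"
proof -
  interpret finite_measure \<mu> by fact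
  have "integrable \<mu> (\<lambda>x. \<bar>U 0\<bar> + norm (gradU 0) + (norm (gradU 0) + L) * (norm x)\<^sup>2)"
    using assms(3) by auto
  then show ?thesis
    by (rule Bochner_Integration.integrable_bound)
       (auto intro: order_trans[OF abs_U_le abs_ge_self])
qed

text \<open>Strong convexity at 0 gives quadratic growth with coefficient \<open>m / 2\<close>. Half
  of it is spent on the linear term through \<open>0 \<le> (2 * a - m * r)\<^sup>2\<close>, so the
  Gaussian rate \<open>m / 4\<close> remains.\<close>

lemma exp_minus_U_le:
  "exp (- U x) \<le> exp (- U 0 + (norm (gradU 0))\<^sup>2 / m) * exp (- (m / 4) * (norm x)\<^sup>2)"
proof -
  define a r where "a = norm (gradU 0)" and "r = norm x"
  have "- (a * r) \<le> gradU 0 \<bullet> x"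
    using Cauchy_Schwarz_ineq2[of "gradU 0" x] by (simp add: a_def r_def abs_le_iff)
  then have "U 0 - a * r + m / 2 * r\<^sup>2 \<le> U x"
    using gradient_lower_bound[of 0 x] by (simp add: r_def)
  moreover have "a * r \<le> a\<^sup>2 / m + m / 4 * r\<^sup>2"
  proof -
    have "0 \<le> (2 * a - m * r)\<^sup>2 / (4 * m)" using m_pos by simp
    then show ?thesis using m_pos by (simp add: field_simps power2_eq_square)
  qed
  ultimately have "- U x \<le> - U 0 + a\<^sup>2 / m + - (m / 4) * r\<^sup>2" by simp
  then show ?thesis by (simp add: exp_add[symmetric] a_def r_def)
qed

lemma integrable_norm_power_exp_minus_U:
  "integrable lborel (\<lambda>x. norm x ^ k * exp (- U x))"
proof (rule Bochner_Integration.integrable_bound)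
  let ?c = "exp (- U 0 + (norm (gradU 0))\<^sup>2 / m)"
  show "integrable lborel (\<lambda>x::'a. ?c * (norm x ^ k * exp (- (m / 4) * (norm x)\<^sup>2)))"
    using integrable_norm_power_exp[of "m / 4" k, where 'a='a] m_pos by simp
  show "AE x in lborel. norm (norm x ^ k * exp (- U x)) \<le> norm (?c * (norm x ^ k * exp (- (m / 4) * (norm x)\<^sup>2)))"
  proof (rule AE_I2)
    fix x :: 'a
    have "norm x ^ k * exp (- U x) \<le> norm x ^ k * (?c * exp (- (m / 4) * (norm x)\<^sup>2))"
      by (intro mult_left_mono exp_minus_U_le) simp
    then show "norm (norm x ^ k * exp (- U x)) \<le> norm (?c * (norm x ^ k * exp (- (m / 4) * (norm x)\<^sup>2)))"
      by (simp add: abs_mult mult_ac)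
  qed
qed measurable

definition partition_function :: real where
  "partition_function = (\<integral>y. exp (- U y) \<partial>lborel)"

lemma integrable_exp_minus_U: "integrable lborel (\<lambda>x. exp (- U x))"
  using integrable_norm_power_exp_minus_U[of 0] by simp

lemma partition_function_pos: "0 < partition_function"
proof -
  have "partition_function \<noteq> 0"
  proof
    assume "partition_function = 0"
    then have "AE x in lborel. exp (- U x) = 0"
      unfolding partition_function_def
      by (subst (asm) integral_nonneg_eq_0_iff_AE[OF integrable_exp_minus_U]) auto
    then have "AE x in (lborel :: 'a measure). False" by simp
    then show False
      by (subst (asm) AE_iff_measurable[where N=UNIV]) auto
  qed
  moreover have "0 \<le> partition_function"
    unfolding partition_function_def by (intro integral_nonneg_AE) auto
  ultimately show ?thesis by simp
qed

lemma gibbs_eq: "gibbs U = density lborel (\<lambda>x. ennreal (exp (- U x) / partition_function))"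
  by (simp add: gibbs_def partition_function_def)

lemma sets_gibbs [simp, measurable_cong]: "sets (gibbs U) = sets borel"
  by (simp add: gibbs_def)

lemma space_gibbs [simp]: "space (gibbs U) = UNIV"
  by (simp add: gibbs_def)

lemma prob_space_gibbs: "prob_space (gibbs U)"
proof (rule prob_spaceI)
  have "(\<integral>\<^sup>+x. ennreal (exp (- U x) / partition_function) \<partial>lborel) = ennreal (\<integral>x. exp (- U x) / partition_function \<partial>lborel)"
    using integrable_exp_minus_U partition_function_pos by (intro nn_integral_eq_integral) auto
  also have "(\<integral>x. exp (- U x) / partition_function \<partial>lborel) = 1"
    using partition_function_pos by (simp add: partition_function_def[symmetric])
  finally show "emeasure (gibbs U) (space (gibbs U)) = 1"
    by (simp add: gibbs_eq emeasure_density)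
qed

lemma integrable_gibbs_norm_power: "integrable (gibbs U) (\<lambda>x. norm x ^ k)"
  unfolding gibbs_eq using integrable_divide[OF integrable_norm_power_exp_minus_U[of k], of partition_function]
    partition_function_pos
  by (subst integrable_density) (auto simp: mult.commute)

section \<open>The coupled Metropolis step\<close>

text \<open>The Metropolis ratio for the target \<open>gibbs U\<close>. The partition function
  cancels in the quotient, and so do the proposal densities because the increment is
  symmetric.\<close>

definition acceptance :: "'a \<Rightarrow> 'a \<Rightarrow> real" where
  "acceptance y z = min 1 (exp (U y - U (y + z)))"

lemma acceptance_nonneg [simp]: "0 \<le> acceptance y z" and acceptance_le_1 [simp]: "acceptance y z \<le> 1"
  by (auto simp: acceptance_def)

lemma measurable_acceptance [measurable (raw)]:
  assumes [measurable]: "f \<in> borel_measurable M" "g \<in> borel_measurable M"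
  shows "(\<lambda>x. acceptance (f x) (g x)) \<in> borel_measurable M"
  unfolding acceptance_def by measurable

text \<open>Detailed balance: Gibbs density times acceptance probability is the minimum of the densities
  at the two end points, hence symmetric, and so is the proposal density.\<close>

lemma metropolis_detailed_balance:
  assumes t: "t > 0" and [measurable]: "f \<in> borel_measurable borel"
  shows "(\<integral>\<^sup>+y. \<integral>\<^sup>+z. ennreal (acceptance y z) * f (y + z) \<partial>heat_kernel t \<partial>gibbs U)
    = (\<integral>\<^sup>+y. \<integral>\<^sup>+z. ennreal (acceptance y z) * f y \<partial>heat_kernel t \<partial>gibbs U)"
proof -
  define p where "p x = exp (- U x) / partition_function" for x
  have [measurable]: "p \<in> borel_measurable borel" unfolding p_def[abs_def] by measurable
  have p: "0 \<le> p x" for x using partition_function_pos by (simp add: p_def)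
  have pa: "p y * acceptance y (y' - y) = min (p y) (p y')" for y y'
  proof -
    have "p y * acceptance y (y' - y) = min (p y * 1) (p y * exp (U y - U y'))"
      unfolding acceptance_def using p[of y] by (simp add: min_mult_distrib_left)
    also have "p y * exp (U y - U y') = p y'"
      by (simp add: p_def exp_diff exp_minus field_simps)
    finally show ?thesis by simp
  qed
  define S where "S y y' = ennreal (min (p y) (p y') * heat_density t (y' - y))" for y y'
  have [measurable (raw)]: "(\<lambda>x. S (f x) (g x)) \<in> borel_measurable M"
    if [measurable]: "f \<in> borel_measurable M" "g \<in> borel_measurable M"
    for f g and M :: "'x measure"
    unfolding S_def by measurable
  have S_sym: "S y y' = S y' y" for y y'
    by (simp add: S_def min.commute heat_density_commute)
  \<comment> \<open>Stated for a function \<open>g\<close> of both end points, because it is used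
    once with the arrival point and once with the starting point; the symmetry of \<open>S\<close>
    exchanges the two.\<close>
  have eq: "(\<integral>\<^sup>+y. \<integral>\<^sup>+z. ennreal (acceptance y z) * g y (y + z) \<partial>heat_kernel t \<partial>gibbs U)
      = (\<integral>\<^sup>+y. \<integral>\<^sup>+y'. S y y' * g y y' \<partial>lborel \<partial>lborel)"
    if [measurable]: "(\<lambda>q. g (fst q) (snd q)) \<in> borel_measurable (borel \<Otimes>\<^sub>M borel)"
    for g :: "'a \<Rightarrow> 'a \<Rightarrow> ennreal"
  proof -
    have [measurable (raw)]: "(\<lambda>x. g (h x) (k x)) \<in> borel_measurable M"
      if "h \<in> borel_measurable M" "k \<in> borel_measurable M" for h k and M :: "'x measure"
      using measurable_compose[OF measurable_Pair[OF that], of "\<lambda>q. g (fst q) (snd q)"] by simp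
    have "(\<integral>\<^sup>+y. \<integral>\<^sup>+z. ennreal (acceptance y z) * g y (y + z) \<partial>heat_kernel t \<partial>gibbs U)
      = (\<integral>\<^sup>+y. ennreal (p y) * (\<integral>\<^sup>+z. ennreal (heat_density t z) * (ennreal (acceptance y z) * g y (y + z)) \<partial>lborel) \<partial>lborel)"
      unfolding gibbs_eq heat_kernel_def p_def[symmetric] by (simp add: nn_integral_density)
    also have "\<dots> = (\<integral>\<^sup>+y. \<integral>\<^sup>+y'. S y y' * g y y' \<partial>lborel \<partial>lborel)"
    proof (rule nn_integral_cong)
      fix y :: 'a
      have "(\<integral>\<^sup>+z. ennreal (heat_density t z) * (ennreal (acceptance y z) * g y (y + z)) \<partial>lborel)
        = (\<integral>\<^sup>+y'. ennreal (heat_density t (y' - y)) * (ennreal (acceptance y (y' - y)) * g y y') \<partial>lborel)"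
        using nn_integral_distr[of "(+) y" lborel borel
          "\<lambda>y'. ennreal (heat_density t (y' - y)) * (ennreal (acceptance y (y' - y)) * g y y')"]
        by (simp add: lborel_distr_plus)
      then have "ennreal (p y) * (\<integral>\<^sup>+z. ennreal (heat_density t z) * (ennreal (acceptance y z) * g y (y + z)) \<partial>lborel)
        = (\<integral>\<^sup>+y'. ennreal (p y) * (ennreal (heat_density t (y' - y)) * (ennreal (acceptance y (y' - y)) * g y y')) \<partial>lborel)"
        by (simp add: nn_integral_cmult)
      also have "\<dots> = (\<integral>\<^sup>+y'. S y y' * g y y' \<partial>lborel)"
        by (intro nn_integral_cong)
           (simp add: S_def pa[symmetric] ennreal_mult p mult_ac)
      finally show "ennreal (p y) * (\<integral>\<^sup>+z. ennreal (heat_density t z) * (ennreal (acceptance y z) * g y (y + z)) \<partial>lborel)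
        = (\<integral>\<^sup>+y'. S y y' * g y y' \<partial>lborel)" .
    qed
    finally show ?thesis .
  qed
  have "(\<integral>\<^sup>+y. \<integral>\<^sup>+z. ennreal (acceptance y z) * f (y + z) \<partial>heat_kernel t \<partial>gibbs U)
      = (\<integral>\<^sup>+y. \<integral>\<^sup>+y'. S y y' * f y' \<partial>lborel \<partial>lborel)"
    by (rule eq) measurable
  also have "\<dots> = (\<integral>\<^sup>+y'. \<integral>\<^sup>+y. S y y' * f y' \<partial>lborel \<partial>lborel)"
    by (rule lborel_pair.Fubini'[symmetric]) (simp add: split_beta')
  also have "\<dots> = (\<integral>\<^sup>+y. \<integral>\<^sup>+y'. S y y' * f y \<partial>lborel \<partial>lborel)"
    by (subst S_sym) simp
  also have "\<dots> = (\<integral>\<^sup>+y. \<integral>\<^sup>+z. ennreal (acceptance y z) * f y \<partial>heat_kernel t \<partial>gibbs U)"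
    by (rule eq[symmetric]) measurable
  finally show ?thesis .
qed

text \<open>The rejected mass is added to both sides of detailed balance. On the right the two
  weights then multiply the same \<open>f y\<close> and sum to 1.\<close>

lemma metropolis_invariant:
  assumes t: "t > 0" and [measurable]: "f \<in> borel_measurable borel"
  shows "(\<integral>\<^sup>+y. \<integral>\<^sup>+z. ennreal (acceptance y z) * f (y + z) + ennreal (1 - acceptance y z) * f y \<partial>heat_kernel t \<partial>gibbs U)
    = (\<integral>\<^sup>+y. f y \<partial>gibbs U)"
proof -
  interpret K: prob_space "heat_kernel t :: 'a measure" using t by (rule prob_space_heat_kernel)
  have "(\<integral>\<^sup>+y. \<integral>\<^sup>+z. ennreal (acceptance y z) * f (y + z) + ennreal (1 - acceptance y z) * f y \<partial>heat_kernel t \<partial>gibbs U)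
    = (\<integral>\<^sup>+y. \<integral>\<^sup>+z. ennreal (acceptance y z) * f (y + z) \<partial>heat_kernel t \<partial>gibbs U)
      + (\<integral>\<^sup>+y. \<integral>\<^sup>+z. ennreal (1 - acceptance y z) * f y \<partial>heat_kernel t \<partial>gibbs U)"
    by (simp add: nn_integral_add)
  also have "\<dots> = (\<integral>\<^sup>+y. \<integral>\<^sup>+z. ennreal (acceptance y z) * f y \<partial>heat_kernel t \<partial>gibbs U)
      + (\<integral>\<^sup>+y. \<integral>\<^sup>+z. ennreal (1 - acceptance y z) * f y \<partial>heat_kernel t \<partial>gibbs U)"
    by (simp only: metropolis_detailed_balance assms)
  also have "\<dots> = (\<integral>\<^sup>+y. \<integral>\<^sup>+z. ennreal (acceptance y z) * f y + ennreal (1 - acceptance y z) * f y \<partial>heat_kernel t \<partial>gibbs U)"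
    by (simp add: nn_integral_add)
  also have "\<dots> = (\<integral>\<^sup>+y. f y \<partial>gibbs U)"
    by (simp add: distrib_right[symmetric] ennreal_plus[symmetric] K.emeasure_space_1[simplified] del: ennreal_plus)
  finally show ?thesis .
qed

end

text \<open>After multiplication by \<open>exp s\<close> it suffices to bound \<open>exp s\<close>
  below by its quadratic Taylor polynomial: the product of the two quadratics is 1 + s^4 / 4. It
  serves as a lower bound for the rejection probability.\<close>

lemma exp_minus_le_quadratic: "exp (- s) \<le> 1 - s + s\<^sup>2 / 2" if "0 \<le> s" for s :: real
proof -
  have "1 * exp (- s) \<le> ((1 - s + s\<^sup>2 / 2) * (1 + s + s\<^sup>2 / 2)) * exp (- s)"
  proof (intro mult_right_mono)
    have "(1 - s + s\<^sup>2 / 2) * (1 + s + s\<^sup>2 / 2) = 1 + (s\<^sup>2)\<^sup>2 / 4"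
      by (simp add: algebra_simps power2_eq_square)
    then show "1 \<le> (1 - s + s\<^sup>2 / 2) * (1 + s + s\<^sup>2 / 2)" by simp
  qed simp
  also have "\<dots> \<le> ((1 - s + s\<^sup>2 / 2) * exp s) * exp (- s)"
  proof (intro mult_right_mono mult_left_mono)
    show "1 + s + s\<^sup>2 / 2 \<le> exp s" using that by (rule exp_lower_Taylor_quadratic)
    have "0 \<le> (1 - s)\<^sup>2 + 1" by (simp add: add_nonneg_nonneg)
    then show "0 \<le> 1 - s + s\<^sup>2 / 2" by (simp add: power2_eq_square algebra_simps)
  qed simp
  also have "\<dots> = 1 - s + s\<^sup>2 / 2" by (simp add: mult.assoc exp_minus)
  finally show ?thesis by simp
qed

text \<open>Integrating out the uniform variable that decides on acceptance returns the two-point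
  mixture of the Metropolis kernel.\<close>

lemma nn_integral_uniform_threshold:
  fixes a :: real and A B :: ennreal
  assumes a: "0 \<le> a" "a \<le> 1"
  shows "(\<integral>\<^sup>+u. (if u \<le> a then A else B) \<partial>uniform_measure lborel {0..1}) = ennreal a * A + ennreal (1 - a) * B"
proof -
  have "(\<integral>\<^sup>+u. (if u \<le> a then A else B) \<partial>uniform_measure lborel {0..1})
     = (\<integral>\<^sup>+u. (if u \<le> a then A else B) * indicator {0..1} u \<partial>lborel)"
    by (subst nn_integral_uniform_measure) (auto simp: divide_ennreal_def)
  also have "\<dots> = (\<integral>\<^sup>+u. A * indicator {0..a} u + B * indicator {a<..1} u \<partial>lborel)"
    using a by (intro nn_integral_cong) (auto split: split_indicator)
  also have "\<dots> = A * ennreal a + B * ennreal (1 - a)"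
    using a by (simp add: nn_integral_add nn_integral_cmult)
  finally show ?thesis by (simp add: mult.commute)
qed

section \<open>Couplings, their marginals and their quadratic cost\<close>

lemma P2_D:
  assumes "\<mu> \<in> P2"
  shows "sets \<mu> = sets borel" "prob_space \<mu>" "integrable \<mu> (\<lambda>x. (norm x)\<^sup>2)"
proof -
  show s: "sets \<mu> = sets borel" "prob_space \<mu>" using assms by (auto simp: P2_def)
  note s(1)[measurable_cong]
  show "integrable \<mu> (\<lambda>x. (norm x)\<^sup>2)"
    using assms by (intro integrableI_bounded) (auto simp: P2_def)
qed

lemma P2_I:
  assumes "sets \<mu> = sets borel" "prob_space \<mu>" "integrable \<mu> (\<lambda>x. (norm x)\<^sup>2)"
  shows "\<mu> \<in> P2"
  using assms by (auto simp: P2_def integrable_iff_bounded)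

lemma couplings_D:
  assumes "\<xi> \<in> couplings \<mu> \<nu>"
  shows "sets \<xi> = sets (borel \<Otimes>\<^sub>M borel)" "prob_space \<xi>" "distr \<xi> borel fst = \<mu>" "distr \<xi> borel snd = \<nu>"
  using assms by (auto simp: couplings_def)

lemma couplings_has_bochner_integral:
  fixes f :: "'a::euclidean_space \<Rightarrow> real"
  assumes "\<xi> \<in> couplings \<mu> \<nu>"
  shows "integrable \<mu> f \<Longrightarrow> has_bochner_integral \<xi> (\<lambda>p. f (fst p)) (\<integral>x. f x \<partial>\<mu>)"
    and "integrable \<nu> f \<Longrightarrow> has_bochner_integral \<xi> (\<lambda>p. f (snd p)) (\<integral>x. f x \<partial>\<nu>)"
proof -
  note c = couplings_D[OF assms]
  note c(1)[measurable_cong]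
  show "has_bochner_integral \<xi> (\<lambda>p. f (fst p)) (\<integral>x. f x \<partial>\<mu>)" if "integrable \<mu> f"
  proof -
    have "f \<in> borel_measurable borel" using that unfolding c(3)[symmetric] by auto
    with that show ?thesis
      unfolding c(3)[symmetric] by (simp add: has_bochner_integral_iff integrable_distr_eq integral_distr)
  qed
  show "has_bochner_integral \<xi> (\<lambda>p. f (snd p)) (\<integral>x. f x \<partial>\<nu>)" if "integrable \<nu> f"
  proof -
    have "f \<in> borel_measurable borel" using that unfolding c(4)[symmetric] by auto
    with that show ?thesis
      unfolding c(4)[symmetric] by (simp add: has_bochner_integral_iff integrable_distr_eq integral_distr)
  qed
qed

lemma norm_diff_sq_le: "(norm (x - y))\<^sup>2 \<le> 2 * (norm x)\<^sup>2 + 2 * (norm y)\<^sup>2"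
  for x y :: "'a::real_inner"
proof -
  have "0 \<le> (norm (x + y))\<^sup>2" by simp
  then show ?thesis by (simp add: power2_norm_eq_inner algebra_simps inner_commute)
qed

lemma integrable_coupling_cost:
  fixes \<mu> :: "'a::euclidean_space measure"
  assumes "\<xi> \<in> couplings \<mu> \<nu>" "\<mu> \<in> P2" "\<nu> \<in> P2"
  shows "integrable \<xi> (\<lambda>p. (norm (fst p - snd p))\<^sup>2)"
proof (rule Bochner_Integration.integrable_bound)
  note couplings_D(1)[OF assms(1), measurable_cong]
  show "integrable \<xi> (\<lambda>p. 2 * (norm (fst p))\<^sup>2 + 2 * (norm (snd p))\<^sup>2)"
    using couplings_has_bochner_integral[OF assms(1)] P2_D(3)[OF assms(2)] P2_D(3)[OF assms(3)]
    by (intro Bochner_Integration.integrable_add integrable_mult_right) (auto simp: has_bochner_integral_iff)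
  show "(\<lambda>p. (norm (fst p - snd p))\<^sup>2) \<in> borel_measurable \<xi>" by measurable
qed (use norm_diff_sq_le in \<open>auto intro!: AE_I2\<close>)

definition transport_cost :: "('a::euclidean_space \<times> 'a) measure \<Rightarrow> real" where
  "transport_cost \<xi> = (\<integral>p. (norm (fst p - snd p))\<^sup>2 \<partial>\<xi>)"

lemma nn_integral_transport_cost:
  assumes "\<xi> \<in> couplings \<mu> \<nu>" "\<mu> \<in> P2" "\<nu> \<in> P2"
  shows "(\<integral>\<^sup>+p. ennreal ((norm (fst p - snd p))\<^sup>2) \<partial>\<xi>) = ennreal (transport_cost \<xi>)"
  unfolding transport_cost_def by (intro nn_integral_eq_integral integrable_coupling_cost[OF assms]) auto

lemma transport_cost_nonneg: "0 \<le> transport_cost \<xi>"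
  unfolding transport_cost_def by (intro integral_nonneg_AE) auto

context strongly_convex_potential
begin

lemma gibbs_in_P2: "gibbs U \<in> P2"
  by (intro P2_I prob_space_gibbs integrable_gibbs_norm_power) simp

text \<open>The extra uniform variable \<open>u\<close> makes the accept-reject decision a
  measurable function of independent noises, so the new coupling is a push-forward of a product
  measure. The first coordinate always takes the increment \<open>z\<close>.\<close>

definition metropolis_coupling :: "real \<Rightarrow> ('a \<times> 'a) measure \<Rightarrow> ('a \<times> 'a) measure" where
  "metropolis_coupling t \<xi> =
    distr (\<xi> \<Otimes>\<^sub>M (heat_kernel t \<Otimes>\<^sub>M uniform_measure lborel {0..1})) (borel \<Otimes>\<^sub>M borel)
      (\<lambda>(p, z, u). (fst p + z, if u \<le> acceptance (snd p) z then snd p + z else snd p))"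

lemma measurable_metropolis_map:
  assumes [measurable_cong]: "sets \<xi> = sets (borel \<Otimes>\<^sub>M borel)"
  shows "(\<lambda>(p, z, u). (fst p + z, if u \<le> acceptance (snd p) z then snd p + z else snd p))
    \<in> \<xi> \<Otimes>\<^sub>M (heat_kernel t \<Otimes>\<^sub>M uniform_measure lborel {0..1}) \<rightarrow>\<^sub>M borel \<Otimes>\<^sub>M borel"
  unfolding split_beta' by measurable

lemma prob_space_metropolis_coupling:
  assumes "sets \<xi> = sets (borel \<Otimes>\<^sub>M borel)" "prob_space \<xi>" "t > 0"
  shows "prob_space (metropolis_coupling t \<xi>)"
proof -
  interpret K: prob_space "heat_kernel t :: 'a measure" using assms by (intro prob_space_heat_kernel)
  interpret V: prob_space "uniform_measure lborel {0..1::real}" by (rule prob_space_uniform_measure) auto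
  interpret KV: pair_prob_space "heat_kernel t :: 'a measure" "uniform_measure lborel {0..1::real}" ..
  interpret KVP: prob_space "(heat_kernel t :: 'a measure) \<Otimes>\<^sub>M uniform_measure lborel {0..1::real}"
    by (rule KV.P.prob_space_axioms)
  interpret X: prob_space \<xi> by fact
  interpret XKV: pair_prob_space \<xi> "(heat_kernel t :: 'a measure) \<Otimes>\<^sub>M uniform_measure lborel {0..1::real}" ..
  show ?thesis
    unfolding metropolis_coupling_def
    by (intro XKV.P.prob_space_distr measurable_metropolis_map assms)
qed

lemma nn_integral_metropolis_coupling:
  assumes \<xi>: "sets \<xi> = sets (borel \<Otimes>\<^sub>M borel)" and t: "t > 0"
    and f [measurable]: "f \<in> borel_measurable (borel \<Otimes>\<^sub>M borel)"
  shows "(\<integral>\<^sup>+p. f p \<partial>metropolis_coupling t \<xi>) =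
    (\<integral>\<^sup>+p. \<integral>\<^sup>+z. ennreal (acceptance (snd p) z) * f (fst p + z, snd p + z)
      + ennreal (1 - acceptance (snd p) z) * f (fst p + z, snd p) \<partial>heat_kernel t \<partial>\<xi>)"
proof -
  interpret K: prob_space "heat_kernel t :: 'a measure" using t by (intro prob_space_heat_kernel)
  interpret V: prob_space "uniform_measure lborel {0..1::real}" by (rule prob_space_uniform_measure) auto
  interpret KV: pair_prob_space "heat_kernel t :: 'a measure" "uniform_measure lborel {0..1::real}" ..
  note \<xi>[measurable_cong]
  have "(\<integral>\<^sup>+p. f p \<partial>metropolis_coupling t \<xi>) =
    (\<integral>\<^sup>+p. \<integral>\<^sup>+z. \<integral>\<^sup>+u. f (fst p + z, if u \<le> acceptance (snd p) z then snd p + z else snd p)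
      \<partial>uniform_measure lborel {0..1} \<partial>heat_kernel t \<partial>\<xi>)"
  proof -
    let ?g = "\<lambda>p z u. f (fst p + z, if u \<le> acceptance (snd p) z then snd p + z else snd p)"
    have "(\<integral>\<^sup>+p. f p \<partial>metropolis_coupling t \<xi>) =
      (\<integral>\<^sup>+q. ?g (fst q) (fst (snd q)) (snd (snd q)) \<partial>(\<xi> \<Otimes>\<^sub>M (heat_kernel t \<Otimes>\<^sub>M uniform_measure lborel {0..1})))"
      unfolding metropolis_coupling_def
      by (subst nn_integral_distr[OF measurable_metropolis_map[OF \<xi>]]) (auto simp: split_beta')
    also have "\<dots> = (\<integral>\<^sup>+p. \<integral>\<^sup>+r. ?g p (fst r) (snd r) \<partial>(heat_kernel t \<Otimes>\<^sub>M uniform_measure lborel {0..1}) \<partial>\<xi>)"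
      using KV.P.nn_integral_fst[of "\<lambda>q. ?g (fst q) (fst (snd q)) (snd (snd q))" \<xi>]
      unfolding fst_conv snd_conv by simp
    also have "\<dots> = (\<integral>\<^sup>+p. \<integral>\<^sup>+z. \<integral>\<^sup>+u. ?g p z u \<partial>uniform_measure lborel {0..1} \<partial>heat_kernel t \<partial>\<xi>)"
      by (intro nn_integral_cong, subst V.nn_integral_fst[symmetric]) (auto cong: if_cong)
    finally show ?thesis .
  qed
  also have "\<dots> = (\<integral>\<^sup>+p. \<integral>\<^sup>+z. \<integral>\<^sup>+u. (if u \<le> acceptance (snd p) z then f (fst p + z, snd p + z) else f (fst p + z, snd p))
      \<partial>uniform_measure lborel {0..1} \<partial>heat_kernel t \<partial>\<xi>)"
    by (intro nn_integral_cong) simp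
  finally show ?thesis by (simp add: nn_integral_uniform_threshold)
qed

text \<open>A function of the first coordinate does not see the decision, so the weights sum to 1
  and plain heat flow remains. A function of the second coordinate sees exactly the Metropolis
  kernel, which preserves \<open>gibbs U\<close>.\<close>

lemma metropolis_coupling_in_couplings:
  assumes \<xi>: "\<xi> \<in> couplings \<nu> (gibbs U)" and t: "t > 0"
  shows "metropolis_coupling t \<xi> \<in> couplings (heat_flow t \<nu>) (gibbs U)"
proof -
  note c = couplings_D[OF \<xi>]
  note c(1)[measurable_cong]
  have \<nu>: "sets \<nu> = sets borel" using c(3) by auto
  have s [measurable_cong]: "sets (metropolis_coupling t \<xi>) = sets (borel \<Otimes>\<^sub>M borel)"
    by (simp add: metropolis_coupling_def)
  interpret K: prob_space "heat_kernel t :: 'a measure" using t by (intro prob_space_heat_kernel)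
  have 1: "distr (metropolis_coupling t \<xi>) borel fst = heat_flow t \<nu>"
  proof (rule measure_eqI_nn_integral)
    fix f :: "'a \<Rightarrow> ennreal" assume f [measurable]: "f \<in> borel_measurable borel"
    have "(\<integral>\<^sup>+x. f x \<partial>distr (metropolis_coupling t \<xi>) borel fst) = (\<integral>\<^sup>+p. f (fst p) \<partial>metropolis_coupling t \<xi>)"
      by (simp add: nn_integral_distr)
    also have "\<dots> = (\<integral>\<^sup>+p. \<integral>\<^sup>+z. ennreal (acceptance (snd p) z) * f (fst p + z)
      + ennreal (1 - acceptance (snd p) z) * f (fst p + z) \<partial>heat_kernel t \<partial>\<xi>)"
      using nn_integral_metropolis_coupling[OF c(1) t, of "\<lambda>p. f (fst p)"] by simp
    also have "\<dots> = (\<integral>\<^sup>+p. \<integral>\<^sup>+z. f (fst p + z) \<partial>heat_kernel t \<partial>\<xi>)"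
      by (simp add: distrib_right[symmetric] ennreal_plus[symmetric] del: ennreal_plus)
    also have "\<dots> = (\<integral>\<^sup>+x. \<integral>\<^sup>+z. f (x + z) \<partial>heat_kernel t \<partial>distr \<xi> borel fst)"
      by (simp add: nn_integral_distr)
    also have "\<dots> = (\<integral>\<^sup>+x. f x \<partial>heat_flow t \<nu>)"
      by (simp add: c(3) nn_integral_heat_flow \<nu> t)
    finally show "(\<integral>\<^sup>+x. f x \<partial>distr (metropolis_coupling t \<xi>) borel fst) = (\<integral>\<^sup>+x. f x \<partial>heat_flow t \<nu>)" .
  qed simp_all
  have 2: "distr (metropolis_coupling t \<xi>) borel snd = gibbs U"
  proof (rule measure_eqI_nn_integral)
    fix f :: "'a \<Rightarrow> ennreal" assume f [measurable]: "f \<in> borel_measurable borel"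
    have "(\<integral>\<^sup>+x. f x \<partial>distr (metropolis_coupling t \<xi>) borel snd) = (\<integral>\<^sup>+p. f (snd p) \<partial>metropolis_coupling t \<xi>)"
      by (simp add: nn_integral_distr)
    also have "\<dots> = (\<integral>\<^sup>+p. \<integral>\<^sup>+z. ennreal (acceptance (snd p) z) * f (snd p + z)
      + ennreal (1 - acceptance (snd p) z) * f (snd p) \<partial>heat_kernel t \<partial>\<xi>)"
      using nn_integral_metropolis_coupling[OF c(1) t, of "\<lambda>p. f (snd p)"] by simp
    also have "\<dots> = (\<integral>\<^sup>+y. \<integral>\<^sup>+z. ennreal (acceptance y z) * f (y + z)
      + ennreal (1 - acceptance y z) * f y \<partial>heat_kernel t \<partial>distr \<xi> borel snd)"
      by (simp add: nn_integral_distr)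
    also have "\<dots> = (\<integral>\<^sup>+x. f x \<partial>gibbs U)"
      by (simp add: c(4) metropolis_invariant t)
    finally show "(\<integral>\<^sup>+x. f x \<partial>distr (metropolis_coupling t \<xi>) borel snd) = (\<integral>\<^sup>+x. f x \<partial>gibbs U)" .
  qed simp_all
  show ?thesis
    using 1 2 s prob_space_metropolis_coupling[OF c(1,2) t] by (simp add: couplings_def)
qed

text \<open>With the energy increment \<open>s\<close>, the rejection probability is 1 - exp(- max 0
  s), which lies within s^2 / 2 of max 0 s. Replacing \<open>s\<close> by its linear part
  \<open>a\<close> costs at most \<open>q\<close>, because the positive part is 1-Lipschitz. The
  second, cruder bound serves where the rejection probability already multiplies
  \<open>(norm z)\<^sup>2\<close>.\<close>

lemma rejection_approximation:
  "\<bar>(1 - acceptance y z) - max 0 (gradU y \<bullet> z)\<bar>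
    \<le> (L / 2 + (norm (gradU y))\<^sup>2) * (norm z)\<^sup>2 + L\<^sup>2 / 4 * norm z ^ 4" (is ?A)
  "1 - acceptance y z \<le> norm (gradU y) * norm z + L / 2 * (norm z)\<^sup>2" (is ?B)
proof -
  define s a where "s = U (y + z) - U y" and "a = gradU y \<bullet> z"
  define q p where "q = L / 2 * (norm z)\<^sup>2" and "p = norm (gradU y) * norm z"
  have q: "\<bar>s - a\<bar> \<le> q"
    using gradient_approximation[of "y + z" y] by (simp add: s_def a_def q_def)
  have p: "\<bar>a\<bar> \<le> p" unfolding a_def p_def by (rule Cauchy_Schwarz_ineq2)
  have acc: "acceptance y z = min 1 (exp (- s))" by (simp add: acceptance_def s_def)
  have le: "1 - acceptance y z \<le> max 0 s"
    using exp_ge_add_one_self[of "- s"] by (auto simp: acc)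
  have "max 0 s - s\<^sup>2 / 2 \<le> 1 - acceptance y z"
  proof (cases "0 \<le> s")
    case True
    with exp_minus_le_quadratic[OF True] show ?thesis by (simp add: acc)
  qed (auto simp: acc)
  with le have "\<bar>(1 - acceptance y z) - max 0 s\<bar> \<le> s\<^sup>2 / 2"
    by (smt (verit) zero_le_power2)
  moreover have "\<bar>max 0 s - max 0 a\<bar> \<le> q" using q by linarith
  moreover have "s\<^sup>2 \<le> 2 * p\<^sup>2 + 2 * q\<^sup>2"
  proof -
    have "\<bar>s\<bar> \<le> p + q" using p q by linarith
    then have "s\<^sup>2 \<le> (p + q)\<^sup>2" using power_mono[of "\<bar>s\<bar>" "p + q" 2] by simp
    moreover have "0 \<le> (p - q)\<^sup>2" by simp
    ultimately show ?thesis by (simp add: power2_eq_square algebra_simps)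
  qed
  moreover have "p\<^sup>2 = (norm (gradU y))\<^sup>2 * (norm z)\<^sup>2" by (simp add: p_def power_mult_distrib)
  moreover have "q\<^sup>2 = L\<^sup>2 / 4 * norm z ^ 4"
    by (simp add: q_def power_mult_distrib power_divide flip: power_mult)
  ultimately have "\<bar>(1 - acceptance y z) - max 0 a\<bar> \<le> q + (norm (gradU y))\<^sup>2 * (norm z)\<^sup>2 + L\<^sup>2 / 4 * norm z ^ 4"
    by linarith
  then show ?A by (simp add: a_def q_def algebra_simps)
  have "1 - acceptance y z \<le> p + q" using le p q by linarith
  then show ?B by (simp add: p_def q_def)
qed

end

text \<open>Since \<open>max 0 r = (r + \<bar>r\<bar>) / 2\<close> and the term with \<open>\<bar>r\<bar>\<close> is odd in \<open>z\<close>, half the covariance remains.\<close>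

lemma heat_kernel_positive_part_covariance:
  fixes w v :: "'a::euclidean_space"
  assumes t: "t > 0"
  shows "has_bochner_integral (heat_kernel t) (\<lambda>z. (w \<bullet> z) * max 0 (v \<bullet> z)) (t * (w \<bullet> v))"
proof -
  have "integrable (heat_kernel t) (\<lambda>z::'a. norm w * norm v * (norm z)\<^sup>2)"
    using heat_kernel_moment(1)[OF t, of 2, where 'a='a] by simp
  then have int: "integrable (heat_kernel t) (\<lambda>z. (w \<bullet> z) * \<bar>v \<bullet> z\<bar>)"
  proof (rule Bochner_Integration.integrable_bound)
    have "\<bar>w \<bullet> z\<bar> * \<bar>v \<bullet> z\<bar> \<le> norm w * norm v * (norm z)\<^sup>2" for z
      using mult_mono[OF Cauchy_Schwarz_ineq2[of w z] Cauchy_Schwarz_ineq2[of v z]]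
      by (simp add: power2_eq_square mult_ac)
    then show "AE z in heat_kernel t. norm ((w \<bullet> z) * \<bar>v \<bullet> z\<bar>) \<le> norm (norm w * norm v * (norm z)\<^sup>2)"
      by (intro AE_I2) (simp add: abs_mult)
  qed simp
  let ?I = "\<integral>z. (w \<bullet> z) * \<bar>v \<bullet> z\<bar> \<partial>heat_kernel t"
  have h: "has_bochner_integral (heat_kernel t) (\<lambda>z. (w \<bullet> z) * \<bar>v \<bullet> z\<bar>) ?I"
    using int by (simp add: has_bochner_integral_iff)
  then have "has_bochner_integral (heat_kernel t) (\<lambda>z. - ((w \<bullet> z) * \<bar>v \<bullet> z\<bar>)) ?I"
    using has_bochner_integral_heat_kernel_uminus[OF t] by fastforce
  with h have "?I = - ?I"
    by (simp add: has_bochner_integral_iff)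
  with h have "has_bochner_integral (heat_kernel t) (\<lambda>z. (w \<bullet> z) * \<bar>v \<bullet> z\<bar>) 0" by simp
  from has_bochner_integral_add[OF heat_kernel_covariance[OF t, of w v] this]
  have "has_bochner_integral (heat_kernel t)
      (\<lambda>z. ((w \<bullet> z) * (v \<bullet> z) + (w \<bullet> z) * \<bar>v \<bullet> z\<bar>) * (1 / 2)) ((2 * t * (w \<bullet> v) + 0) * (1 / 2))"
    by (rule has_bochner_integral_mult_left)
  moreover have "((w \<bullet> z) * (v \<bullet> z) + (w \<bullet> z) * \<bar>v \<bullet> z\<bar>) * (1 / 2) = (w \<bullet> z) * max 0 (v \<bullet> z)" for z
    by (auto simp: max_def abs_if)
  ultimately show ?thesis by simp
qed

context strongly_convex_potential
begin

text \<open>Acceptance keeps the difference \<open>w\<close>, rejection turns it into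
  \<open>w + z\<close>. With rejection probability r the mean squared distance grows by the mean of
  r (2 (w \<bullet> z) + |z|^2). Replacing r by \<open>max 0 (v \<bullet> z)\<close> in the cross
  term gives \<open>2 * t * (w \<bullet> v)\<close>; everything else has degree 3 to 5 in
  \<open>norm z\<close> and is of order \<open>sqrt t ^ 3\<close> for
  \<open>t \<le> 1\<close>.\<close>

lemma metropolis_pointwise:
  assumes t: "0 < t" "t \<le> 1"
  defines "C \<equiv> (1 + 8 ^ 5 * fact 5 * 2 powr (DIM('a) / 2)) * (2 + 2 * L + L\<^sup>2)"
  defines "R \<equiv> \<lambda>x y. (norm (x - y))\<^sup>2 + 2 * t * (U x - U y)
      + C * sqrt t ^ 3 * (1 + (norm (x - y))\<^sup>2 + norm (gradU y) ^ 4)"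
  shows "(\<integral>\<^sup>+z. ennreal (acceptance y z) * ennreal ((norm (x + z - (y + z)))\<^sup>2)
      + ennreal (1 - acceptance y z) * ennreal ((norm (x + z - y))\<^sup>2) \<partial>heat_kernel t) \<le> ennreal (R x y)"
    and "0 \<le> R x y"
proof -
  define w v where "w = x - y" and "v = gradU y"
  define E where "E z = norm w * (L + 2 * (norm v)\<^sup>2) * norm z ^ 3 + norm w * (L\<^sup>2 / 2) * norm z ^ 5
      + norm v * norm z ^ 3 + L / 2 * norm z ^ 4" for z :: 'a
  define G where "G z = (norm w)\<^sup>2 + 2 * ((w \<bullet> z) * max 0 (v \<bullet> z)) + E z" for z :: 'a
  have pt: "acceptance y z * (norm w)\<^sup>2 + (1 - acceptance y z) * (norm (w + z))\<^sup>2 \<le> G z" for z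
  proof -
    define r where "r = 1 - acceptance y z"
    define n where "n = norm z"
    have n: "0 \<le> n" by (simp add: n_def)
    have "acceptance y z * (norm w)\<^sup>2 + (1 - acceptance y z) * (norm (w + z))\<^sup>2
      = (norm w)\<^sup>2 + 2 * (w \<bullet> z) * r + r * n\<^sup>2"
      unfolding r_def n_def power2_norm_eq_inner by (simp add: algebra_simps inner_commute)
    moreover have "2 * (w \<bullet> z) * r \<le> 2 * ((w \<bullet> z) * max 0 (v \<bullet> z))
        + 2 * (norm w * n * ((L / 2 + (norm v)\<^sup>2) * n\<^sup>2 + L\<^sup>2 / 4 * n ^ 4))"
    proof -
      have "(w \<bullet> z) * (r - max 0 (v \<bullet> z)) \<le> \<bar>w \<bullet> z\<bar> * \<bar>r - max 0 (v \<bullet> z)\<bar>"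
        by (metis abs_ge_self abs_mult)
      also have "\<dots> \<le> (norm w * n) * ((L / 2 + (norm v)\<^sup>2) * n\<^sup>2 + L\<^sup>2 / 4 * n ^ 4)"
        unfolding r_def n_def v_def
        by (intro mult_mono rejection_approximation(1) Cauchy_Schwarz_ineq2) auto
      finally show ?thesis by (simp add: algebra_simps)
    qed
    moreover have "r * n\<^sup>2 \<le> (norm v * n + L / 2 * n\<^sup>2) * n\<^sup>2"
      unfolding r_def n_def v_def by (intro mult_right_mono rejection_approximation(2)) auto
    ultimately have "acceptance y z * (norm w)\<^sup>2 + (1 - acceptance y z) * (norm (w + z))\<^sup>2
      \<le> (norm w)\<^sup>2 + 2 * ((w \<bullet> z) * max 0 (v \<bullet> z))
        + 2 * (norm w * n * ((L / 2 + (norm v)\<^sup>2) * n\<^sup>2 + L\<^sup>2 / 4 * n ^ 4)) + (norm v * n + L / 2 * n\<^sup>2) * n\<^sup>2"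
      by linarith
    also have "\<dots> = G z"
      by (simp add: G_def E_def n_def[symmetric] algebra_simps power2_eq_square power3_eq_cube power4_eq_xxxx)
        (simp add: eval_nat_numeral)
    finally show ?thesis .
  qed
  have G_nonneg: "0 \<le> G z" for z
    by (rule order_trans[OF _ pt]) simp
  define M where "M k = (\<integral>z. norm (z::'a) ^ k \<partial>heat_kernel t)" for k
  have M: "has_bochner_integral (heat_kernel t) (\<lambda>z::'a. norm z ^ k) (M k)" for k
    using heat_kernel_moment(1)[OF t(1), of k, where 'a='a] by (simp add: M_def has_bochner_integral_iff)
  interpret K: prob_space "heat_kernel t :: 'a measure" using t(1) by (rule prob_space_heat_kernel)
  define IE where "IE = norm w * (L + 2 * (norm v)\<^sup>2) * M 3 + norm w * (L\<^sup>2 / 2) * M 5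
      + norm v * M 3 + L / 2 * M 4"
  have "has_bochner_integral (heat_kernel t) (\<lambda>_::'a. (norm w)\<^sup>2) ((norm w)\<^sup>2)"
    using K.prob_space by (simp add: has_bochner_integral_iff)
  then have hG: "has_bochner_integral (heat_kernel t) G ((norm w)\<^sup>2 + 2 * (t * (w \<bullet> v)) + IE)"
    unfolding G_def[abs_def] E_def[abs_def] IE_def
    by (intro has_bochner_integral_add has_bochner_integral_mult_right M
        heat_kernel_positive_part_covariance t)
  \<comment> \<open>The moment constant for the highest degree 5. It dominates those of degrees 3
    and 4, and \<open>t \<le> 1\<close> reduces all powers of \<open>sqrt t\<close> to the
    third.\<close>
  define C0 where "C0 = 1 + 8 ^ 5 * fact 5 * 2 powr (DIM('a) / 2)"
  have C0: "0 \<le> C0" by (simp add: C0_def add_nonneg_nonneg)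
  have Mle: "M k \<le> C0 * sqrt t ^ 3" if "3 \<le> k" "k \<le> 5" for k
  proof -
    have "M k \<le> (1 + 8 ^ k * fact k * 2 powr (DIM('a) / 2)) * sqrt t ^ k"
      unfolding M_def by (rule heat_kernel_moment(2)[OF t(1)])
    also have "\<dots> \<le> C0 * sqrt t ^ 3"
      unfolding C0_def using t that
      by (intro mult_mono add_left_mono mult_right_mono power_increasing fact_mono power_decreasing
          add_nonneg_nonneg) auto
    finally show ?thesis .
  qed
  have "IE \<le> norm w * (L + 2 * (norm v)\<^sup>2) * (C0 * sqrt t ^ 3) + norm w * (L\<^sup>2 / 2) * (C0 * sqrt t ^ 3)
      + norm v * (C0 * sqrt t ^ 3) + L / 2 * (C0 * sqrt t ^ 3)"
    unfolding IE_def using L_pos by (intro add_mono mult_left_mono Mle) auto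
  also have "\<dots> = (C0 * sqrt t ^ 3) * (norm w * (L + 2 * (norm v)\<^sup>2) + norm w * (L\<^sup>2 / 2) + norm v + L / 2)"
    by (simp add: algebra_simps)
  also have "\<dots> \<le> (C0 * sqrt t ^ 3) * ((2 + 2 * L + L\<^sup>2) * (1 + (norm w)\<^sup>2 + norm v ^ 4))"
  proof (rule mult_left_mono)
    define a b where "a = norm w" and "b = norm v"
    have sq: "c \<le> 1 + c\<^sup>2" for c :: real
    proof -
      have "0 \<le> (c - 1 / 2)\<^sup>2" by simp
      then show ?thesis unfolding power2_diff by (simp add: field_simps power2_eq_square)
    qed
    have b4: "b ^ 4 = (b\<^sup>2)\<^sup>2" by (simp flip: power_mult)
    \<comment> \<open>The mixed term 2 a b^2 is the reason why the error carries a fourth power of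
      the gradient: it is split into a^2 and b^4.\<close>
    have "0 \<le> (a - b\<^sup>2)\<^sup>2" by simp
    then have 1: "2 * a * b\<^sup>2 \<le> a\<^sup>2 + b ^ 4" unfolding power2_diff b4 by simp
    have "0 \<le> (b\<^sup>2 - 1 / 2)\<^sup>2" by simp
    then have 2: "b \<le> 2 + b ^ 4" using sq[of b] sq[of "b\<^sup>2"] unfolding b4 by linarith
    have "(L + L\<^sup>2 / 2) * a \<le> (L + L\<^sup>2 / 2) * (1 + a\<^sup>2)"
      using sq L_pos by (intro mult_left_mono) auto
    with 1 2 have "a * (L + 2 * b\<^sup>2) + a * (L\<^sup>2 / 2) + b + L / 2
        \<le> (a\<^sup>2 + b ^ 4) + (L + L\<^sup>2 / 2) * (1 + a\<^sup>2) + (2 + b ^ 4) + L / 2"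
      by (simp add: algebra_simps)
    also have "\<dots> \<le> (2 + 2 * L + L\<^sup>2) * (1 + a\<^sup>2 + b ^ 4)"
    proof -
      define S where "S = 1 + a\<^sup>2 + b ^ 4"
      have S: "1 \<le> S" "1 + a\<^sup>2 \<le> S" by (simp_all add: S_def)
      have "(L + L\<^sup>2 / 2) * (1 + a\<^sup>2) \<le> (L + L\<^sup>2 / 2) * S" "L * 1 \<le> L * S" "0 \<le> L * S" "0 \<le> L\<^sup>2 * S"
        using S L_pos by (auto intro!: mult_left_mono)
      moreover have "(a\<^sup>2 + b ^ 4) + (2 + b ^ 4) \<le> 2 * S" by (simp add: S_def)
      moreover have "(L + L\<^sup>2 / 2) * S = L * S + (L\<^sup>2 * S) / 2"
        "(2 + 2 * L + L\<^sup>2) * S = 2 * S + 2 * (L * S) + L\<^sup>2 * S"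
        by (simp_all add: distrib_right)
      ultimately show ?thesis unfolding S_def[symmetric] by linarith
    qed
    finally show "norm w * (L + 2 * (norm v)\<^sup>2) + norm w * (L\<^sup>2 / 2) + norm v + L / 2
        \<le> (2 + 2 * L + L\<^sup>2) * (1 + (norm w)\<^sup>2 + norm v ^ 4)"
      by (simp only: a_def b_def)
  qed (use C0 t in auto)
  also have "\<dots> = C * sqrt t ^ 3 * (1 + (norm w)\<^sup>2 + norm v ^ 4)"
    by (simp add: C_def C0_def mult_ac)
  finally have IE: "IE \<le> C * sqrt t ^ 3 * (1 + (norm w)\<^sup>2 + norm v ^ 4)" .
  \<comment> \<open>Convexity turns the drift into an energy difference. The quadratic gain is
    dropped: the contraction factor of the theorem comes from the gradient step alone.\<close>
  have "w \<bullet> v \<le> U x - U y"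
  proof -
    have "0 \<le> m / 2 * (norm (x - y))\<^sup>2" using m_pos by auto
    then show ?thesis
      using gradient_lower_bound[of y x] by (simp add: w_def v_def inner_commute)
  qed
  then have "2 * (t * (w \<bullet> v)) \<le> 2 * t * (U x - U y)" using t by simp
  with IE have le: "(norm w)\<^sup>2 + 2 * (t * (w \<bullet> v)) + IE \<le> R x y"
    unfolding R_def by (simp add: w_def v_def)
  have int: "integral\<^sup>L (heat_kernel t) G = (norm w)\<^sup>2 + 2 * (t * (w \<bullet> v)) + IE"
    using hG by (simp add: has_bochner_integral_iff)
  \<comment> \<open>The sign of \<open>R x y\<close> is not visible from its formula, which contains
    an energy difference; it is inherited from \<open>G\<close>, which dominates a weighted mean of
    squares.\<close>
  have "0 \<le> integral\<^sup>L (heat_kernel t) G"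
    using G_nonneg by (intro integral_nonneg_AE) auto
  with le int show "0 \<le> R x y" by simp
  have "(\<integral>\<^sup>+z. ennreal (acceptance y z) * ennreal ((norm (x + z - (y + z)))\<^sup>2)
      + ennreal (1 - acceptance y z) * ennreal ((norm (x + z - y))\<^sup>2) \<partial>heat_kernel t)
    \<le> (\<integral>\<^sup>+z. ennreal (G z) \<partial>heat_kernel t)"
  proof (rule nn_integral_mono)
    fix z :: 'a
    have eq: "x + z - (y + z) = w" "x + z - y = w + z" by (simp_all add: w_def)
    show "ennreal (acceptance y z) * ennreal ((norm (x + z - (y + z)))\<^sup>2)
      + ennreal (1 - acceptance y z) * ennreal ((norm (x + z - y))\<^sup>2) \<le> ennreal (G z)"
      unfolding eq using pt[of z] by (simp add: ennreal_mult[symmetric] ennreal_plus[symmetric] ennreal_leI del: ennreal_plus)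
  qed
  also have "\<dots> = ennreal ((norm w)\<^sup>2 + 2 * (t * (w \<bullet> v)) + IE)"
    using hG G_nonneg by (subst nn_integral_eq_integral) (auto simp: has_bochner_integral_iff)
  also have "\<dots> \<le> ennreal (R x y)" by (intro ennreal_leI le)
  finally show "(\<integral>\<^sup>+z. ennreal (acceptance y z) * ennreal ((norm (x + z - (y + z)))\<^sup>2)
      + ennreal (1 - acceptance y z) * ennreal ((norm (x + z - y))\<^sup>2) \<partial>heat_kernel t) \<le> ennreal (R x y)" .
qed

end

section \<open>Second moments and energy along the heat flow\<close>

lemma heat_kernel_norm_add_sq:
  fixes x :: "'a::euclidean_space"
  assumes t: "t > 0"
  shows "has_bochner_integral (heat_kernel t) (\<lambda>z. (norm (x + z))\<^sup>2) ((norm x)\<^sup>2 + 2 * t * DIM('a))"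
proof -
  interpret K: prob_space "heat_kernel t :: 'a measure" using t by (rule prob_space_heat_kernel)
  have "has_bochner_integral (heat_kernel t) (\<lambda>_::'a. (norm x)\<^sup>2) ((norm x)\<^sup>2)"
    using K.prob_space by (simp add: has_bochner_integral_iff)
  from has_bochner_integral_add[OF has_bochner_integral_add[OF this
      has_bochner_integral_mult_right[where c=2, OF heat_kernel_mean[OF t, of x]]]
      heat_kernel_second_moment[OF t, where 'a='a]]
  have "has_bochner_integral (heat_kernel t) (\<lambda>z. (norm x)\<^sup>2 + 2 * (x \<bullet> z) + (norm z)\<^sup>2)
      ((norm x)\<^sup>2 + 2 * 0 + 2 * t * DIM('a))" .
  moreover have "(norm x)\<^sup>2 + 2 * (x \<bullet> z) + (norm z)\<^sup>2 = (norm (x + z))\<^sup>2" for z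
    unfolding power2_norm_eq_inner by (simp add: algebra_simps inner_commute)
  ultimately show ?thesis by simp
qed

lemma heat_flow_in_P2:
  fixes \<nu> :: "'a::euclidean_space measure"
  assumes \<nu>: "\<nu> \<in> P2" and t: "t > 0"
  shows "heat_flow t \<nu> \<in> P2"
    and "(\<integral>x. (norm x)\<^sup>2 \<partial>heat_flow t \<nu>) = (\<integral>x. (norm x)\<^sup>2 \<partial>\<nu>) + 2 * t * DIM('a)"
proof -
  note n = P2_D[OF \<nu>]
  note n(1)[measurable_cong]
  interpret prob_space \<nu> by (rule n(2))
  have "(\<integral>\<^sup>+x. ennreal ((norm x)\<^sup>2) \<partial>heat_flow t \<nu>) = (\<integral>\<^sup>+x. \<integral>\<^sup>+z. ennreal ((norm (x + z))\<^sup>2) \<partial>heat_kernel t \<partial>\<nu>)"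
    by (intro nn_integral_heat_flow n t) measurable
  also have "\<dots> = (\<integral>\<^sup>+x. ennreal ((norm x)\<^sup>2 + 2 * t * DIM('a)) \<partial>\<nu>)"
    using heat_kernel_norm_add_sq[OF t, where 'a='a]
    by (intro nn_integral_cong, subst nn_integral_eq_integral) (auto simp: has_bochner_integral_iff)
  also have "\<dots> = ennreal ((\<integral>x. (norm x)\<^sup>2 \<partial>\<nu>) + 2 * t * DIM('a))"
    using n(3) t prob_space by (subst nn_integral_eq_integral) auto
  finally have eq: "(\<integral>\<^sup>+x. ennreal ((norm x)\<^sup>2) \<partial>heat_flow t \<nu>) = ennreal ((\<integral>x. (norm x)\<^sup>2 \<partial>\<nu>) + 2 * t * DIM('a))" .
  then show "heat_flow t \<nu> \<in> P2"
    using prob_space_heat_flow[OF n(2,1) t] by (simp add: P2_def)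
  have "0 \<le> (\<integral>x. (norm x)\<^sup>2 \<partial>\<nu>) + 2 * t * DIM('a)"
    using t by (intro add_nonneg_nonneg integral_nonneg_AE) auto
  then show "(\<integral>x. (norm x)\<^sup>2 \<partial>heat_flow t \<nu>) = (\<integral>x. (norm x)\<^sup>2 \<partial>\<nu>) + 2 * t * DIM('a)"
    using eq by (subst integral_eq_nn_integral) auto
qed

lemma heat_flow_integral:
  fixes f :: "'a::euclidean_space \<Rightarrow> real"
  assumes \<nu>: "prob_space \<nu>" "sets \<nu> = sets borel" and t: "t > 0"
    and int: "integrable (heat_flow t \<nu>) f"
  shows "integrable \<nu> (\<lambda>x. \<integral>z. f (x + z) \<partial>heat_kernel t)"
    and "(\<integral>x. f x \<partial>heat_flow t \<nu>) = (\<integral>x. \<integral>z. f (x + z) \<partial>heat_kernel t \<partial>\<nu>)"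
proof -
  note \<nu>(2)[measurable_cong]
  interpret prob_space \<nu> by fact
  interpret K: prob_space "heat_kernel t :: 'a measure" using t by (rule prob_space_heat_kernel)
  interpret pair_prob_space \<nu> "heat_kernel t :: 'a measure" ..
  have [measurable]: "f \<in> borel_measurable borel"
    using borel_measurable_integrable[OF int] by simp
  have "integrable (\<nu> \<Otimes>\<^sub>M heat_kernel t) (\<lambda>p. f (fst p + snd p))"
    using int unfolding heat_flow_def by (subst (asm) integrable_distr_eq) (auto simp: split_beta')
  from integrable_fst'[OF this] integral_fst'[OF this]
  show "integrable \<nu> (\<lambda>x. \<integral>z. f (x + z) \<partial>heat_kernel t)"
    and "(\<integral>x. f x \<partial>heat_flow t \<nu>) = (\<integral>x. \<integral>z. f (x + z) \<partial>heat_kernel t \<partial>\<nu>)"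
    by (auto simp: heat_flow_def integral_distr split_beta')
qed

context strongly_convex_potential
begin

lemma integrable_U_P2: "\<mu> \<in> P2 \<Longrightarrow> integrable \<mu> U"
  using P2_D[of \<mu>] by (intro integrable_U) (auto intro: prob_space.finite_measure)

text \<open>In the quadratic upper bound at \<open>x\<close> the linear term has mean zero, and L /
  2 times the second moment 2 t d is the stated increase.\<close>

lemma heat_flow_integral_U:
  assumes \<nu>: "\<nu> \<in> P2" and t: "t > 0"
  shows "(\<integral>x. U x \<partial>heat_flow t \<nu>) \<le> (\<integral>x. U x \<partial>\<nu>) + L * t * DIM('a)"
proof -
  note n = P2_D[OF \<nu>]
  interpret prob_space \<nu> by (rule n(2))
  interpret K: prob_space "heat_kernel t :: 'a measure" using t by (rule prob_space_heat_kernel)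
  note f = heat_flow_integral[OF n(2,1) t integrable_U_P2[OF heat_flow_in_P2(1)[OF \<nu> t]]]
  have le: "(\<integral>z. U (x + z) \<partial>heat_kernel t) \<le> U x + L * t * DIM('a)" for x
  proof -
    have "has_bochner_integral (heat_kernel t) (\<lambda>_::'a. U x) (U x)"
      using K.prob_space by (simp add: has_bochner_integral_iff)
    from has_bochner_integral_add[OF has_bochner_integral_add[OF this heat_kernel_mean[OF t, of "gradU x"]]
        has_bochner_integral_mult_right[OF heat_kernel_second_moment[OF t], where c="L / 2"]]
    have h: "has_bochner_integral (heat_kernel t) (\<lambda>z. U x + gradU x \<bullet> z + L / 2 * (norm z)\<^sup>2) (U x + L * t * DIM('a))"
      by (simp add: mult.assoc)
    have "integrable (heat_kernel t) (\<lambda>z. \<bar>U 0\<bar> + norm (gradU 0) + (norm (gradU 0) + L) * (norm (x + z))\<^sup>2)"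
      using heat_kernel_norm_add_sq[OF t, of x] by (auto simp: has_bochner_integral_iff)
    then have int: "integrable (heat_kernel t) (\<lambda>z. U (x + z))"
      by (rule Bochner_Integration.integrable_bound) (auto intro: order_trans[OF abs_U_le abs_ge_self])
    have "(\<integral>z. U (x + z) \<partial>heat_kernel t) \<le> (\<integral>z. U x + gradU x \<bullet> z + L / 2 * (norm z)\<^sup>2 \<partial>heat_kernel t)"
    proof (intro integral_mono int)
      show "U (x + z) \<le> U x + gradU x \<bullet> z + L / 2 * (norm z)\<^sup>2" for z
        using gradient_upper_bound[of "x + z" x] by simp
    qed (use h in \<open>auto simp: has_bochner_integral_iff\<close>)
    with h show ?thesis by (simp add: has_bochner_integral_iff)
  qed
  have "(\<integral>x. U x \<partial>heat_flow t \<nu>) \<le> (\<integral>x. U x + L * t * DIM('a) \<partial>\<nu>)"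
    unfolding f(2) using f(1) le integrable_U_P2[OF \<nu>] by (intro integral_mono) auto
  also have "\<dots> = (\<integral>x. U x \<partial>\<nu>) + L * t * DIM('a)"
    using integrable_U_P2[OF \<nu>] prob_space by simp
  finally show ?thesis .
qed

text \<open>The gradient grows at most linearly and \<open>gibbs U\<close> has all moments.\<close>

lemma integrable_gradU_power4: "integrable (gibbs U) (\<lambda>y. norm (gradU y) ^ 4)"
proof (rule Bochner_Integration.integrable_bound)
  interpret prob_space "gibbs U" by (rule prob_space_gibbs)
  show "integrable (gibbs U) (\<lambda>y. 8 * norm (gradU 0) ^ 4 + 8 * L ^ 4 * norm y ^ 4)"
    using integrable_gibbs_norm_power[of 4] by auto
  show "AE y in gibbs U. norm (norm (gradU y) ^ 4) \<le> norm (8 * norm (gradU 0) ^ 4 + 8 * L ^ 4 * norm y ^ 4)"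
  proof (rule AE_I2)
    fix y :: 'a
    define a b where "a = norm (gradU 0)" and "b = L * norm y"
    have sq: "(c + d)\<^sup>2 \<le> 2 * c\<^sup>2 + 2 * d\<^sup>2" for c d :: real
    proof -
      have "0 \<le> (c - d)\<^sup>2" by simp
      then show ?thesis by (simp add: power2_eq_square algebra_simps)
    qed
    have "norm (gradU y) ^ 4 \<le> (a + b) ^ 4"
      using norm_gradU_le[of y] by (intro power_mono) (auto simp: a_def b_def)
    also have "\<dots> = ((a + b)\<^sup>2)\<^sup>2" by (simp flip: power_mult)
    also have "\<dots> \<le> (2 * a\<^sup>2 + 2 * b\<^sup>2)\<^sup>2" by (intro power_mono sq) simp
    also have "\<dots> \<le> 2 * (2 * a\<^sup>2)\<^sup>2 + 2 * (2 * b\<^sup>2)\<^sup>2" by (rule sq)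
    also have "\<dots> = 8 * a ^ 4 + 8 * b ^ 4" by (simp add: power_mult_distrib flip: power_mult)
    finally have "norm (gradU y) ^ 4 \<le> 8 * norm (gradU 0) ^ 4 + 8 * L ^ 4 * norm y ^ 4"
      by (simp add: a_def b_def power_mult_distrib)
    then show "norm (norm (gradU y) ^ 4) \<le> norm (8 * norm (gradU 0) ^ 4 + 8 * L ^ 4 * norm y ^ 4)"
      by simp
  qed
qed measurable

section \<open>Cost of one coupled step and of many\<close>

definition step_constant :: real where
  "step_constant = (1 + 8 ^ 5 * fact 5 * 2 powr (DIM('a) / 2)) * (2 + 2 * L + L\<^sup>2)"

lemma step_constant_nonneg: "0 \<le> step_constant"
  unfolding step_constant_def using L_pos by (intro mult_nonneg_nonneg add_nonneg_nonneg) auto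

text \<open>The share of the error that depends on the second marginal, and hence is the same at
  every step. The factor 2 comes from \<open>norm_diff_sq_le\<close>.\<close>

definition gibbs_moments :: real where
  "gibbs_moments = 1 + 2 * (\<integral>y. (norm y)\<^sup>2 \<partial>gibbs U) + (\<integral>y. norm (gradU y) ^ 4 \<partial>gibbs U)"

text \<open>The pointwise bound is integrated over \<open>\<xi>\<close>. Inside the error term the
  cost of \<open>\<xi>\<close> is replaced by second moments of the marginals, so the error does not
  depend on the coupling and does not build up under iteration.\<close>

lemma metropolis_cost:
  assumes \<xi>: "\<xi> \<in> couplings \<nu> (gibbs U)" and \<nu>: "\<nu> \<in> P2" and t: "0 < t" "t \<le> 1"
  shows "transport_cost (metropolis_coupling t \<xi>) \<le> transport_cost \<xi>
    + 2 * t * ((\<integral>x. U x \<partial>\<nu>) - (\<integral>y. U y \<partial>gibbs U))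
    + step_constant * sqrt t ^ 3 * (gibbs_moments + 2 * (\<integral>x. (norm x)\<^sup>2 \<partial>\<nu>))"
proof -
  note c = couplings_D[OF \<xi>]
  interpret prob_space \<xi> by (rule c(2))
  note chbi = couplings_has_bochner_integral[OF \<xi>]
  let ?R = "\<lambda>p. (norm (fst p - snd p))\<^sup>2 + 2 * t * (U (fst p) - U (snd p))
      + step_constant * sqrt t ^ 3 * (1 + (norm (fst p - snd p))\<^sup>2 + norm (gradU (snd p)) ^ 4)"
  let ?IR = "transport_cost \<xi> + 2 * t * ((\<integral>x. U x \<partial>\<nu>) - (\<integral>y. U y \<partial>gibbs U))
      + step_constant * sqrt t ^ 3 * (1 + transport_cost \<xi> + (\<integral>y. norm (gradU y) ^ 4 \<partial>gibbs U))"
  have cost: "has_bochner_integral \<xi> (\<lambda>p. (norm (fst p - snd p))\<^sup>2) (transport_cost \<xi>)"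
    unfolding transport_cost_def
    using integrable_coupling_cost[OF \<xi> \<nu> gibbs_in_P2] by (simp add: has_bochner_integral_iff)
  have one: "has_bochner_integral \<xi> (\<lambda>_. 1) (1 :: real)"
    using prob_space by (simp add: has_bochner_integral_iff)
  have R: "has_bochner_integral \<xi> ?R ?IR"
    by (intro has_bochner_integral_add has_bochner_integral_diff has_bochner_integral_mult_right cost one
        chbi(1)[OF integrable_U_P2[OF \<nu>]] chbi(2)[OF integrable_U_P2[OF gibbs_in_P2]]
        chbi(2)[OF integrable_gradU_power4])
  have R_nonneg: "0 \<le> ?R p" for p
    unfolding step_constant_def by (rule metropolis_pointwise(2)[OF t])
  have IR_nonneg: "0 \<le> ?IR"
    unfolding has_bochner_integral_integral_eq[OF R, symmetric]
    by (intro integral_nonneg_AE AE_I2 R_nonneg)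
  have le: "transport_cost \<xi> \<le> 2 * (\<integral>x. (norm x)\<^sup>2 \<partial>\<nu>) + 2 * (\<integral>y. (norm y)\<^sup>2 \<partial>gibbs U)"
  proof -
    have h: "has_bochner_integral \<xi> (\<lambda>p. 2 * (norm (fst p))\<^sup>2 + 2 * (norm (snd p))\<^sup>2)
      (2 * (\<integral>x. (norm x)\<^sup>2 \<partial>\<nu>) + 2 * (\<integral>y. (norm y)\<^sup>2 \<partial>gibbs U))"
      by (intro has_bochner_integral_add has_bochner_integral_mult_right
          chbi(1)[OF P2_D(3)[OF \<nu>]] chbi(2)[OF P2_D(3)[OF gibbs_in_P2]])
    have "transport_cost \<xi> \<le> (\<integral>p. 2 * (norm (fst p))\<^sup>2 + 2 * (norm (snd p))\<^sup>2 \<partial>\<xi>)"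
      unfolding transport_cost_def using cost h norm_diff_sq_le
      by (intro integral_mono) (auto simp: has_bochner_integral_iff)
    with h show ?thesis by (simp add: has_bochner_integral_iff)
  qed
  have "ennreal (transport_cost (metropolis_coupling t \<xi>)) =
      (\<integral>\<^sup>+p. ennreal ((norm (fst p - snd p))\<^sup>2) \<partial>metropolis_coupling t \<xi>)"
    by (rule nn_integral_transport_cost[OF metropolis_coupling_in_couplings[OF \<xi> t(1)]
        heat_flow_in_P2(1)[OF \<nu> t(1)] gibbs_in_P2, symmetric])
  also have "\<dots> = (\<integral>\<^sup>+p. \<integral>\<^sup>+z. ennreal (acceptance (snd p) z) * ennreal ((norm (fst p + z - (snd p + z)))\<^sup>2)
      + ennreal (1 - acceptance (snd p) z) * ennreal ((norm (fst p + z - snd p))\<^sup>2) \<partial>heat_kernel t \<partial>\<xi>)"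
    using nn_integral_metropolis_coupling[OF c(1) t(1), of "\<lambda>p. ennreal ((norm (fst p - snd p))\<^sup>2)"] by simp
  also have "\<dots> \<le> (\<integral>\<^sup>+p. ennreal (?R p) \<partial>\<xi>)"
    unfolding step_constant_def by (intro nn_integral_mono metropolis_pointwise(1) t)
  also have "\<dots> = ennreal ?IR"
    using R R_nonneg by (subst nn_integral_eq_integral) (auto simp: has_bochner_integral_iff)
  finally have "transport_cost (metropolis_coupling t \<xi>) \<le> ?IR"
    using IR_nonneg by simp
  also have "\<dots> \<le> transport_cost \<xi> + 2 * t * ((\<integral>x. U x \<partial>\<nu>) - (\<integral>y. U y \<partial>gibbs U))
    + step_constant * sqrt t ^ 3 * (gibbs_moments + 2 * (\<integral>x. (norm x)\<^sup>2 \<partial>\<nu>))"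
    using le step_constant_nonneg t by (intro add_left_mono mult_left_mono) (auto simp: gibbs_moments_def)
  finally show ?thesis .
qed

text \<open>The increment \<open>D\<close> is fixed by the total time \<open>real N * t\<close>
  while the induction runs over \<open>k \<le> N\<close>: the energy bound and the second moment
  both increase with time, so their final values serve for every step. They are carried along
  because \<open>metropolis_cost\<close> needs them for the current first marginal.\<close>

lemma metropolis_iterate:
  fixes N :: nat and t :: real
  assumes \<xi>: "\<xi> \<in> couplings \<nu> (gibbs U)" and \<nu>: "\<nu> \<in> P2" and t: "0 < t" "t \<le> 1"
  defines "D \<equiv> 2 * t * ((\<integral>x. U x \<partial>\<nu>) + L * (real N * t) * DIM('a) - (\<integral>y. U y \<partial>gibbs U))
      + step_constant * sqrt t ^ 3 * (gibbs_moments + 2 * ((\<integral>x. (norm x)\<^sup>2 \<partial>\<nu>) + 2 * (real N * t) * DIM('a)))"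
  assumes "k \<le> N"
  shows "(heat_flow t ^^ k) \<nu> \<in> P2
    \<and> (\<integral>x. (norm x)\<^sup>2 \<partial>(heat_flow t ^^ k) \<nu>) = (\<integral>x. (norm x)\<^sup>2 \<partial>\<nu>) + 2 * (real k * t) * DIM('a)
    \<and> (\<integral>x. U x \<partial>(heat_flow t ^^ k) \<nu>) \<le> (\<integral>x. U x \<partial>\<nu>) + L * (real k * t) * DIM('a)
    \<and> (\<exists>\<xi>'\<in>couplings ((heat_flow t ^^ k) \<nu>) (gibbs U). transport_cost \<xi>' \<le> transport_cost \<xi> + real k * D)"
  using \<open>k \<le> N\<close>
proof (induction k)
  case 0
  with \<xi> \<nu> show ?case by auto
next
  case (Suc k)
  let ?\<nu> = "(heat_flow t ^^ k) \<nu>"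
  from Suc obtain \<xi>' where IH: "?\<nu> \<in> P2"
    "(\<integral>x. (norm x)\<^sup>2 \<partial>?\<nu>) = (\<integral>x. (norm x)\<^sup>2 \<partial>\<nu>) + 2 * (real k * t) * DIM('a)"
    "(\<integral>x. U x \<partial>?\<nu>) \<le> (\<integral>x. U x \<partial>\<nu>) + L * (real k * t) * DIM('a)"
    "\<xi>' \<in> couplings ?\<nu> (gibbs U)" "transport_cost \<xi>' \<le> transport_cost \<xi> + real k * D"
    by auto
  have kN: "real k * t \<le> real N * t" using Suc.prems t by (intro mult_right_mono) auto
  have U: "(\<integral>x. U x \<partial>?\<nu>) \<le> (\<integral>x. U x \<partial>\<nu>) + L * (real N * t) * DIM('a)"
    using IH(3) mult_right_mono[OF mult_left_mono[OF kN, of L], of "real DIM('a)"] L_pos by linarith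
  have "(\<integral>x. (norm x)\<^sup>2 \<partial>?\<nu>) \<le> (\<integral>x. (norm x)\<^sup>2 \<partial>\<nu>) + 2 * (real N * t) * DIM('a)"
    using IH(2) mult_right_mono[OF mult_left_mono[OF kN, of 2], of "real DIM('a)"] by linarith
  then have "step_constant * sqrt t ^ 3 * (gibbs_moments + 2 * (\<integral>x. (norm x)\<^sup>2 \<partial>?\<nu>))
    \<le> step_constant * sqrt t ^ 3 * (gibbs_moments + 2 * ((\<integral>x. (norm x)\<^sup>2 \<partial>\<nu>) + 2 * (real N * t) * DIM('a)))"
    using step_constant_nonneg t by (intro mult_left_mono) auto
  moreover have "2 * t * ((\<integral>x. U x \<partial>?\<nu>) - (\<integral>y. U y \<partial>gibbs U))
    \<le> 2 * t * ((\<integral>x. U x \<partial>\<nu>) + L * (real N * t) * DIM('a) - (\<integral>y. U y \<partial>gibbs U))"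
    using U t by (intro mult_left_mono) auto
  ultimately have "transport_cost (metropolis_coupling t \<xi>') \<le> transport_cost \<xi>' + D"
    unfolding D_def using metropolis_cost[OF IH(4,1) t] by linarith
  also have "\<dots> \<le> transport_cost \<xi> + real (Suc k) * D"
    using IH(5) by (simp add: algebra_simps)
  finally have cost: "transport_cost (metropolis_coupling t \<xi>') \<le> transport_cost \<xi> + real (Suc k) * D" .
  have "(\<integral>x. U x \<partial>heat_flow t ?\<nu>) \<le> (\<integral>x. U x \<partial>\<nu>) + L * (real (Suc k) * t) * DIM('a)"
    using heat_flow_integral_U[OF IH(1) t(1)] IH(3) by (simp add: algebra_simps)
  moreover have "(\<integral>x. (norm x)\<^sup>2 \<partial>heat_flow t ?\<nu>) = (\<integral>x. (norm x)\<^sup>2 \<partial>\<nu>) + 2 * (real (Suc k) * t) * DIM('a)"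
    using heat_flow_in_P2(2)[OF IH(1) t(1)] IH(2) by (simp add: algebra_simps)
  ultimately show ?case
    using cost heat_flow_in_P2(1)[OF IH(1) t(1)] metropolis_coupling_in_couplings[OF IH(4) t(1)]
    by auto
qed

end

text \<open>Counted from \<open>Suc k\<close> because time 0 is degenerate:
  \<open>heat_density 0\<close> is the zero function (\<open>0 powr a = 0\<close>), so
  \<open>heat_flow 0\<close> is not the identity.\<close>

lemma heat_flow_funpow:
  fixes t :: real
  assumes "sets \<nu> = sets (borel :: 'a::euclidean_space measure)" "t > 0"
  shows "(heat_flow t ^^ Suc k) \<nu> = heat_flow (real (Suc k) * t) \<nu>"
proof (induction k)
  case (Suc k)
  have "(heat_flow t ^^ Suc (Suc k)) \<nu> = heat_flow t (heat_flow (real (Suc k) * t) \<nu>)"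
    using Suc by simp
  also have "\<dots> = heat_flow (t + real (Suc k) * t) \<nu>"
    using assms by (intro heat_flow_heat_flow) auto
  finally show ?case by (simp add: algebra_simps)
qed simp

text \<open>The infimum under the root of \<open>W2\<close>. All estimates are made at this level,
  and the root is undone once, in \<open>W2_power2\<close>.\<close>

definition W2sq :: "'a::euclidean_space measure \<Rightarrow> 'a measure \<Rightarrow> ennreal" where
  "W2sq \<mu> \<nu> = (INF \<xi> \<in> couplings \<mu> \<nu>. \<integral>\<^sup>+ z. ennreal ((norm (fst z - snd z))\<^sup>2) \<partial>\<xi>)"

lemma ennreal_sqrt_power2: "(ennreal_sqrt x)\<^sup>2 = x"
  by (cases x) (auto simp: ennreal_sqrt_def power2_eq_square ennreal_top_mult ennreal_mult[symmetric])

lemma W2_power2: "(W2 \<mu> \<nu>)\<^sup>2 = W2sq \<mu> \<nu>"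
  by (simp only: W2_def W2sq_def ennreal_sqrt_power2)

lemma W2sq_le:
  assumes "\<xi> \<in> couplings \<mu> \<nu>" "\<mu> \<in> P2" "\<nu> \<in> P2"
  shows "W2sq \<mu> \<nu> \<le> ennreal (transport_cost \<xi>)"
  unfolding W2sq_def nn_integral_transport_cost[OF assms, symmetric]
  by (rule INF_lower) fact

section \<open>The limit of vanishing step length\<close>

context strongly_convex_potential
begin

text \<open>By the semigroup property the left side does not depend on the number of steps, so only
  the numerical bound passes to the limit; no limit of couplings is taken.\<close>

lemma heat_flow_W2sq:
  assumes \<xi>: "\<xi> \<in> couplings \<nu> (gibbs U)" and \<nu>: "\<nu> \<in> P2" and \<gamma>: "\<gamma> > 0"
  shows "W2sq (heat_flow \<gamma> \<nu>) (gibbs U) \<le> ennreal (transport_cost \<xi>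
    + 2 * \<gamma> * ((\<integral>x. U x \<partial>\<nu>) + L * \<gamma> * DIM('a) - (\<integral>y. U y \<partial>gibbs U)))"
proof -
  define B where "B = transport_cost \<xi> + 2 * \<gamma> * ((\<integral>x. U x \<partial>\<nu>) + L * \<gamma> * DIM('a) - (\<integral>y. U y \<partial>gibbs U))"
  define F where "F = \<gamma> * step_constant * (gibbs_moments + 2 * ((\<integral>x. (norm x)\<^sup>2 \<partial>\<nu>) + 2 * \<gamma> * DIM('a)))"
  have bound: "W2sq (heat_flow \<gamma> \<nu>) (gibbs U) \<le> ennreal (B + F * sqrt (\<gamma> / real (Suc k)))"
    if k: "\<gamma> \<le> real (Suc k)" for k
  proof -
    define t where "t = \<gamma> / real (Suc k)"
    have t: "0 < t" "t \<le> 1" using k \<gamma> by (auto simp: t_def)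
    have Nt: "real (Suc k) * t = \<gamma>" by (simp add: t_def)
    have flow: "(heat_flow t ^^ Suc k) \<nu> = heat_flow \<gamma> \<nu>"
      unfolding heat_flow_funpow[OF P2_D(1)[OF \<nu>] t(1)] Nt ..
    from metropolis_iterate[OF \<xi> \<nu> t le_refl, of "Suc k"] obtain \<xi>' where
      \<xi>': "\<xi>' \<in> couplings (heat_flow \<gamma> \<nu>) (gibbs U)" and
      le: "transport_cost \<xi>' \<le> transport_cost \<xi> + real (Suc k) *
       (2 * t * ((\<integral>x. U x \<partial>\<nu>) + L * \<gamma> * DIM('a) - (\<integral>y. U y \<partial>gibbs U))
      + step_constant * sqrt t ^ 3 * (gibbs_moments + 2 * ((\<integral>x. (norm x)\<^sup>2 \<partial>\<nu>) + 2 * \<gamma> * DIM('a))))"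
      unfolding flow Nt by blast
    \<comment> \<open>The total error: as many steps as \<open>Suc k\<close>, each of order
      \<open>sqrt t ^ 3\<close>, give \<open>\<gamma> * sqrt t\<close>, which tends to 0.\<close>
    have "real (Suc k) * sqrt t ^ 3 = (real (Suc k) * t) * sqrt t"
      using t by (simp add: power3_eq_cube)
    then have 3: "real (Suc k) * sqrt t ^ 3 = \<gamma> * sqrt t" by (simp only: Nt)
    have "real (Suc k) * (2 * t * a + step_constant * sqrt t ^ 3 * b)
      = 2 * (real (Suc k) * t) * a + (real (Suc k) * sqrt t ^ 3) * step_constant * b" for a b
      by (simp add: algebra_simps)
    then have e: "real (Suc k) * (2 * t * a + step_constant * sqrt t ^ 3 * b)
      = 2 * \<gamma> * a + \<gamma> * sqrt t * step_constant * b" for a b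
      by (simp only: 3 Nt)
    have "transport_cost \<xi>' \<le> B + F * sqrt t"
      using le unfolding e by (simp only: B_def F_def add.assoc mult_ac)
    then have "ennreal (transport_cost \<xi>') \<le> ennreal (B + F * sqrt t)" by (rule ennreal_leI)
    with W2sq_le[OF \<xi>' heat_flow_in_P2(1)[OF \<nu> \<gamma>] gibbs_in_P2] show ?thesis
      by (simp add: t_def)
  qed
  have "(\<lambda>k. B + F * sqrt (\<gamma> / real (Suc k))) \<longlonglongrightarrow> B + F * sqrt 0"
    by (intro tendsto_intros LIMSEQ_Suc lim_const_over_n)
  then have "(\<lambda>k. ennreal (B + F * sqrt (\<gamma> / real (Suc k)))) \<longlonglongrightarrow> ennreal (B + F * sqrt 0)"
    by (rule tendsto_ennrealI)
  \<comment> \<open>Beyond \<open>k0\<close> the step length \<gamma> / (k + 1) is at most 1, as the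
    one-step estimate requires.\<close>
  moreover obtain k0 :: nat where "\<gamma> \<le> real k0" using real_arch_simple by blast
  then have "\<forall>k\<ge>k0. W2sq (heat_flow \<gamma> \<nu>) (gibbs U) \<le> ennreal (B + F * sqrt (\<gamma> / real (Suc k)))"
    by (intro allI impI bound) auto
  ultimately have "W2sq (heat_flow \<gamma> \<nu>) (gibbs U) \<le> ennreal (B + F * sqrt 0)"
    by (intro LIMSEQ_le_const) blast+
  then show ?thesis by (simp add: B_def)
qed

end

section \<open>The unadjusted Langevin step\<close>

lemma ula_kernel_eq:
  fixes gU :: "'a::euclidean_space \<Rightarrow> 'a"
  shows "ula_kernel gU \<gamma> x = distr (heat_kernel \<gamma>) borel (\<lambda>z. (x - \<gamma> *\<^sub>R gU x) + z)"
proof (rule measure_eqI_nn_integral)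
  fix f :: "'a \<Rightarrow> ennreal" assume f [measurable]: "f \<in> borel_measurable borel"
  let ?c = "x - \<gamma> *\<^sub>R gU x"
  have "(\<integral>\<^sup>+y. f y \<partial>ula_kernel gU \<gamma> x) = (\<integral>\<^sup>+y. ennreal (heat_density \<gamma> (y - ?c)) * f y \<partial>lborel)"
    unfolding ula_kernel_def by (subst nn_integral_density) (auto simp: heat_density_def algebra_simps)
  also have "\<dots> = (\<integral>\<^sup>+z. ennreal (heat_density \<gamma> z) * f (?c + z) \<partial>lborel)"
    using nn_integral_distr[of "(+) ?c" lborel borel "\<lambda>y. ennreal (heat_density \<gamma> (y - ?c)) * f y"]
    by (simp add: lborel_distr_plus)
  also have "\<dots> = (\<integral>\<^sup>+y. f y \<partial>distr (heat_kernel \<gamma>) borel (\<lambda>z. ?c + z))"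
    by (simp add: nn_integral_distr heat_kernel_def nn_integral_density)
  finally show "(\<integral>\<^sup>+y. f y \<partial>ula_kernel gU \<gamma> x) = (\<integral>\<^sup>+y. f y \<partial>distr (heat_kernel \<gamma>) borel (\<lambda>z. ?c + z))" .
qed (simp_all add: ula_kernel_def)

lemma measurable_ula_kernel:
  fixes gU :: "'a::euclidean_space \<Rightarrow> 'a"
  assumes [measurable]: "gU \<in> borel_measurable borel" and \<gamma>: "\<gamma> > 0"
  shows "ula_kernel gU \<gamma> \<in> borel \<rightarrow>\<^sub>M subprob_algebra borel"
proof -
  have "(heat_kernel \<gamma> :: 'a measure) \<in> space (subprob_algebra borel)"
    using prob_space_heat_kernel[OF \<gamma>, where 'a='a]
    by (simp add: space_subprob_algebra prob_space_imp_subprob_space)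
  then show ?thesis
    unfolding ula_kernel_eq[abs_def] by (intro measurable_distr2[where M=borel] measurable_const) measurable
qed

lemma measurable_ula_iter:
  fixes gU :: "'a::euclidean_space \<Rightarrow> 'a"
  assumes "gU \<in> borel_measurable borel" "\<And>k. k \<ge> 1 \<Longrightarrow> \<gamma> k > 0"
  shows "ula_iter gU \<gamma> n \<in> borel \<rightarrow>\<^sub>M subprob_algebra borel"
proof (induction n)
  case 0
  have "ula_iter gU \<gamma> 0 = return borel" by auto
  then show ?case by simp
next
  case (Suc n)
  have "ula_iter gU \<gamma> (Suc n) = (\<lambda>x. bind (ula_iter gU \<gamma> n x) (ula_kernel gU (\<gamma> (Suc n))))" by auto
  then show ?case
    using assms by (simp add: measurable_bind2[OF Suc] measurable_ula_kernel)
qed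

lemma bind_ula_iter_Suc:
  fixes gU :: "'a::euclidean_space \<Rightarrow> 'a"
  assumes "gU \<in> borel_measurable borel" "\<And>k. k \<ge> 1 \<Longrightarrow> \<gamma> k > 0" and \<mu>: "sets \<mu> = sets borel"
  shows "bind \<mu> (ula_iter gU \<gamma> (Suc n)) = bind (bind \<mu> (ula_iter gU \<gamma> n)) (ula_kernel gU (\<gamma> (Suc n)))"
proof -
  note \<mu>[measurable_cong]
  have "ula_iter gU \<gamma> n \<in> \<mu> \<rightarrow>\<^sub>M subprob_algebra borel"
    using measurable_ula_iter[OF assms(1,2)] by simp
  moreover have "ula_iter gU \<gamma> (Suc n) = (\<lambda>x. bind (ula_iter gU \<gamma> n x) (ula_kernel gU (\<gamma> (Suc n))))" by auto
  ultimately show ?thesis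
    using assms by (simp only: bind_assoc[where N=borel and R=borel] measurable_ula_kernel le_add1 plus_1_eq_Suc[symmetric])
qed

lemma bind_ula_kernel:
  fixes gU :: "'a::euclidean_space \<Rightarrow> 'a"
  assumes gU [measurable]: "gU \<in> borel_measurable borel" and \<gamma>: "\<gamma> > 0"
    and \<mu>: "sets \<mu> = sets borel" "prob_space \<mu>"
  shows "bind \<mu> (ula_kernel gU \<gamma>) = heat_flow \<gamma> (distr \<mu> borel (\<lambda>x. x - \<gamma> *\<^sub>R gU x))"
proof (rule measure_eqI_nn_integral)
  note \<mu>(1)[measurable_cong]
  interpret prob_space \<mu> by fact
  interpret K: prob_space "heat_kernel \<gamma> :: 'a measure" using \<gamma> by (rule prob_space_heat_kernel)
  have k: "ula_kernel gU \<gamma> \<in> \<mu> \<rightarrow>\<^sub>M subprob_algebra borel"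
    using measurable_ula_kernel[OF gU \<gamma>] by simp
  show "sets (\<mu> \<bind> ula_kernel gU \<gamma>) = sets borel"
    by (rule sets_bind) (auto simp: ula_kernel_def not_empty)
  fix f :: "'a \<Rightarrow> ennreal" assume f [measurable]: "f \<in> borel_measurable borel"
  show "(\<integral>\<^sup>+x. f x \<partial>(\<mu> \<bind> ula_kernel gU \<gamma>)) =
      (\<integral>\<^sup>+x. f x \<partial>heat_flow \<gamma> (distr \<mu> borel (\<lambda>x. x - \<gamma> *\<^sub>R gU x)))"
    by (simp add: nn_integral_bind[OF f k] nn_integral_heat_flow \<gamma> ula_kernel_eq nn_integral_distr)
qed simp

section \<open>From bounds on couplings to the squared distance\<close>

lemma pair_measure_in_couplings:
  fixes \<mu> \<nu> :: "'a::euclidean_space measure"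
  assumes \<mu>: "sets \<mu> = sets borel" "prob_space \<mu>" and \<nu>: "sets \<nu> = sets borel" "prob_space \<nu>"
  shows "\<mu> \<Otimes>\<^sub>M \<nu> \<in> couplings \<mu> \<nu>"
proof -
  note \<mu>(1)[measurable_cong] \<nu>(1)[measurable_cong]
  interpret M: prob_space \<mu> by fact
  interpret N: prob_space \<nu> by fact
  interpret pair_prob_space \<mu> \<nu> ..
  have "distr (\<mu> \<Otimes>\<^sub>M \<nu>) borel fst = \<mu>"
  proof (rule measure_eqI_nn_integral)
    fix f :: "'a \<Rightarrow> ennreal" assume [measurable]: "f \<in> borel_measurable borel"
    show "(\<integral>\<^sup>+x. f x \<partial>distr (\<mu> \<Otimes>\<^sub>M \<nu>) borel fst) = (\<integral>\<^sup>+x. f x \<partial>\<mu>)"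
      by (simp add: nn_integral_distr N.nn_integral_fst[symmetric] N.emeasure_space_1)
  qed (simp_all add: \<mu>)
  moreover have "distr (\<mu> \<Otimes>\<^sub>M \<nu>) borel snd = \<nu>"
  proof (rule measure_eqI_nn_integral)
    fix f :: "'a \<Rightarrow> ennreal" assume [measurable]: "f \<in> borel_measurable borel"
    show "(\<integral>\<^sup>+x. f x \<partial>distr (\<mu> \<Otimes>\<^sub>M \<nu>) borel snd) = (\<integral>\<^sup>+x. f x \<partial>\<nu>)"
      by (simp add: nn_integral_distr N.nn_integral_fst[symmetric] M.emeasure_space_1)
  qed (simp_all add: \<nu>)
  moreover have "sets (\<mu> \<Otimes>\<^sub>M \<nu>) = sets (borel \<Otimes>\<^sub>M borel)"
    using \<mu>(1) \<nu>(1) by (rule sets_pair_measure_cong)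
  ultimately show ?thesis
    using P.prob_space_axioms by (simp add: couplings_def)
qed

text \<open>A bound valid for every coupling passes to the infimum by inserting couplings that are
  optimal up to an arbitrarily small amount.\<close>

lemma W2sq_affine_bound:
  fixes \<mu> \<nu> :: "'a::euclidean_space measure"
  assumes \<mu>: "\<mu> \<in> P2" and \<nu>: "\<nu> \<in> P2" and a: "0 \<le> a" and b: "0 \<le> b"
    and le: "\<And>\<xi>. \<xi> \<in> couplings \<mu> \<nu> \<Longrightarrow> x \<le> ennreal (a * transport_cost \<xi> + b)"
  shows "x \<le> ennreal a * W2sq \<mu> \<nu> + ennreal b"
proof -
  \<comment> \<open>The product coupling has finite cost; a finite infimum is what allows
    approximation up to a positive error.\<close>
  obtain \<xi>0 where "\<xi>0 \<in> couplings \<mu> \<nu>"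
    using pair_measure_in_couplings P2_D[OF \<mu>] P2_D[OF \<nu>] by blast
  from W2sq_le[OF this \<mu> \<nu>] have fin: "W2sq \<mu> \<nu> \<noteq> \<infinity>"
    by (metis ennreal_less_top infinity_ennreal_def leD)
  show ?thesis
  proof (rule ennreal_le_epsilon)
    fix e :: real assume e: "0 < e"
    \<comment> \<open>The denominator \<open>a + 1\<close> instead of \<open>a\<close> covers the
      case \<open>a = 0\<close>.\<close>
    define e' where "e' = e / (a + 1)"
    have e': "0 < e'" and ae: "a * e' \<le> e" using a e by (auto simp: e'_def field_simps)
    obtain \<xi> where \<xi>: "\<xi> \<in> couplings \<mu> \<nu>" and
      "(\<integral>\<^sup>+ z. ennreal ((norm (fst z - snd z))\<^sup>2) \<partial>\<xi>) < W2sq \<mu> \<nu> + ennreal e'"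
      using INF_approx_ennreal[OF e' W2sq_def fin] by blast
    then have lt: "ennreal (transport_cost \<xi>) < W2sq \<mu> \<nu> + ennreal e'"
      by (simp add: nn_integral_transport_cost[OF \<xi> \<mu> \<nu>])
    have "x \<le> ennreal (a * transport_cost \<xi> + b)" by (rule le[OF \<xi>])
    also have "\<dots> = ennreal a * ennreal (transport_cost \<xi>) + ennreal b"
      using a b transport_cost_nonneg[of \<xi>] by (simp add: ennreal_plus ennreal_mult)
    also have "\<dots> \<le> ennreal a * (W2sq \<mu> \<nu> + ennreal e') + ennreal b"
      using lt by (intro add_right_mono mult_left_mono) auto
    also have "\<dots> = ennreal a * W2sq \<mu> \<nu> + ennreal b + ennreal (a * e')"
      using a e' by (simp add: distrib_left ennreal_mult add_ac)
    also have "\<dots> \<le> ennreal a * W2sq \<mu> \<nu> + ennreal b + ennreal e"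
      using ae by (intro add_left_mono ennreal_leI)
    finally show "x \<le> ennreal a * W2sq \<mu> \<nu> + ennreal b + ennreal e" .
  qed
qed

section \<open>One full step and its iteration\<close>

context strongly_convex_potential
begin

lemma gradient_step_in_P2:
  assumes \<mu>: "\<mu> \<in> P2"
  shows "distr \<mu> borel (\<lambda>x. x - \<gamma> *\<^sub>R gradU x) \<in> P2"
proof (rule P2_I)
  note n = P2_D[OF \<mu>]
  note n(1)[measurable_cong]
  interpret prob_space \<mu> by (rule n(2))
  show "prob_space (distr \<mu> borel (\<lambda>x. x - \<gamma> *\<^sub>R gradU x))" by (rule prob_space_distr) measurable
  have "integrable \<mu> (\<lambda>x. (norm (x - \<gamma> *\<^sub>R gradU x))\<^sup>2)"
  proof (rule Bochner_Integration.integrable_bound)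
    let ?g = "\<lambda>x. 2 * (norm x)\<^sup>2 + 2 * (\<gamma>\<^sup>2 * (2 * (L\<^sup>2 * (norm x)\<^sup>2) + 2 * (norm (gradU 0))\<^sup>2))"
    show "integrable \<mu> ?g" using n(3) by auto
    show "AE x in \<mu>. norm ((norm (x - \<gamma> *\<^sub>R gradU x))\<^sup>2) \<le> norm (?g x)"
    proof (rule AE_I2)
      fix x :: 'a
      have "(norm (gradU x))\<^sup>2 \<le> 2 * (norm (gradU x - gradU 0))\<^sup>2 + 2 * (norm (gradU 0))\<^sup>2"
        using norm_diff_sq_le[of "gradU x - gradU 0" "- gradU 0"] by simp
      also have "(norm (gradU x - gradU 0))\<^sup>2 \<le> (L * norm x)\<^sup>2"
        using lipschitz[of x 0] by (intro power_mono) auto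
      finally have "(norm (gradU x))\<^sup>2 \<le> 2 * (L\<^sup>2 * (norm x)\<^sup>2) + 2 * (norm (gradU 0))\<^sup>2"
        by (simp add: power_mult_distrib)
      then have "\<gamma>\<^sup>2 * (norm (gradU x))\<^sup>2 \<le> \<gamma>\<^sup>2 * (2 * (L\<^sup>2 * (norm x)\<^sup>2) + 2 * (norm (gradU 0))\<^sup>2)"
        by (intro mult_left_mono) auto
      moreover have "(norm (x - \<gamma> *\<^sub>R gradU x))\<^sup>2 \<le> 2 * (norm x)\<^sup>2 + 2 * (\<gamma>\<^sup>2 * (norm (gradU x))\<^sup>2)"
        using norm_diff_sq_le[of x "\<gamma> *\<^sub>R gradU x"] by (simp add: power_mult_distrib)
      ultimately have "(norm (x - \<gamma> *\<^sub>R gradU x))\<^sup>2 \<le> ?g x" by linarith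
      then show "norm ((norm (x - \<gamma> *\<^sub>R gradU x))\<^sup>2) \<le> norm (?g x)" by simp
    qed
  qed measurable
  then show "integrable (distr \<mu> borel (\<lambda>x. x - \<gamma> *\<^sub>R gradU x)) (\<lambda>x. (norm x)\<^sup>2)"
    by (subst integrable_distr_eq) auto
qed simp

text \<open>Only the first coordinate of \<open>\<xi>\<close> is moved, so the second marginal stays
  \<open>gibbs U\<close>; the pointwise estimate \<open>gradient_step\<close> is then
  integrated.\<close>

lemma gradient_step_coupling:
  assumes \<xi>: "\<xi> \<in> couplings \<mu> (gibbs U)" and \<mu>: "\<mu> \<in> P2" and \<gamma>: "0 < \<gamma>" "\<gamma> \<le> 1 / L"
  defines "\<mu>' \<equiv> distr \<mu> borel (\<lambda>x. x - \<gamma> *\<^sub>R gradU x)"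
  obtains \<xi>' where "\<xi>' \<in> couplings \<mu>' (gibbs U)"
    "transport_cost \<xi>' \<le> (1 - m * \<gamma>) * transport_cost \<xi>
      - 2 * \<gamma> * ((\<integral>x. U x \<partial>\<mu>') - (\<integral>y. U y \<partial>gibbs U))"
proof
  note c = couplings_D[OF \<xi>]
  note c(1)[measurable_cong] P2_D(1)[OF \<mu>, measurable_cong]
  interpret prob_space \<xi> by (rule c(2))
  define \<xi>' where "\<xi>' = distr \<xi> (borel \<Otimes>\<^sub>M borel) (\<lambda>p. (fst p - \<gamma> *\<^sub>R gradU (fst p), snd p))"
  have s [measurable_cong]: "sets \<xi>' = sets (borel \<Otimes>\<^sub>M borel)" by (simp add: \<xi>'_def)
  have "distr \<xi>' borel fst = distr (distr \<xi> borel fst) borel (\<lambda>x. x - \<gamma> *\<^sub>R gradU x)"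
    unfolding \<xi>'_def by (simp add: distr_distr comp_def)
  moreover have "distr \<xi>' borel snd = distr \<xi> borel snd"
    unfolding \<xi>'_def by (simp add: distr_distr comp_def)
  moreover have "prob_space \<xi>'"
    unfolding \<xi>'_def by (rule prob_space_distr) measurable
  ultimately show in': "\<xi>' \<in> couplings \<mu>' (gibbs U)"
    using s by (simp add: couplings_def c \<mu>'_def)
  note chbi' = couplings_has_bochner_integral[OF in']
  have P': "\<mu>' \<in> P2" unfolding \<mu>'_def by (rule gradient_step_in_P2[OF \<mu>])
  let ?T = "\<lambda>p. (fst p - \<gamma> *\<^sub>R gradU (fst p), snd p)"
  \<comment> \<open>Brings the integrals over the new coupling back to \<open>\<xi>\<close>, so that
    both sides of the estimate are integrals over one measure and can be compared pointwise.\<close>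
  have pull: "has_bochner_integral \<xi> (\<lambda>p. f (?T p)) I"
    if "has_bochner_integral \<xi>' f I" for f :: "_ \<Rightarrow> real" and I
  proof -
    have [measurable]: "f \<in> borel_measurable (borel \<Otimes>\<^sub>M borel)"
      using that s by (auto simp: has_bochner_integral_iff dest!: borel_measurable_integrable)
    show ?thesis
      using that unfolding \<xi>'_def has_bochner_integral_iff
      by (simp add: integrable_distr_eq integral_distr)
  qed
  have cost: "has_bochner_integral \<xi> (\<lambda>p. (norm (fst p - snd p))\<^sup>2) (transport_cost \<xi>)"
    unfolding transport_cost_def
    using integrable_coupling_cost[OF \<xi> \<mu> gibbs_in_P2] by (simp add: has_bochner_integral_iff)
  have "has_bochner_integral \<xi>' (\<lambda>p. (norm (fst p - snd p))\<^sup>2) (transport_cost \<xi>')"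
    unfolding transport_cost_def
    using integrable_coupling_cost[OF in' P' gibbs_in_P2] by (simp add: has_bochner_integral_iff)
  from pull[OF this]
  have cost': "has_bochner_integral \<xi> (\<lambda>p. (norm (fst p - \<gamma> *\<^sub>R gradU (fst p) - snd p))\<^sup>2) (transport_cost \<xi>')"
    by simp
  have "has_bochner_integral \<xi>' (\<lambda>p. U (fst p) - U (snd p)) ((\<integral>x. U x \<partial>\<mu>') - (\<integral>y. U y \<partial>gibbs U))"
    by (intro has_bochner_integral_diff chbi'(1)[OF integrable_U_P2[OF P']]
        chbi'(2)[OF integrable_U_P2[OF gibbs_in_P2]])
  from pull[OF this]
  have "has_bochner_integral \<xi> (\<lambda>p. U (fst p - \<gamma> *\<^sub>R gradU (fst p)) - U (snd p))
      ((\<integral>x. U x \<partial>\<mu>') - (\<integral>y. U y \<partial>gibbs U))" by simp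
  from has_bochner_integral_diff[OF has_bochner_integral_mult_right[OF cost, of "1 - m * \<gamma>"]
      has_bochner_integral_mult_right[OF this, of "2 * \<gamma>"]]
  have R: "has_bochner_integral \<xi> (\<lambda>p. (1 - m * \<gamma>) * (norm (fst p - snd p))\<^sup>2
      - 2 * \<gamma> * (U (fst p - \<gamma> *\<^sub>R gradU (fst p)) - U (snd p)))
    ((1 - m * \<gamma>) * transport_cost \<xi> - 2 * \<gamma> * ((\<integral>x. U x \<partial>\<mu>') - (\<integral>y. U y \<partial>gibbs U)))" .
  show "transport_cost \<xi>' \<le> (1 - m * \<gamma>) * transport_cost \<xi>
      - 2 * \<gamma> * ((\<integral>x. U x \<partial>\<mu>') - (\<integral>y. U y \<partial>gibbs U))"
    unfolding has_bochner_integral_integral_eq[OF R, symmetric]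
      has_bochner_integral_integral_eq[OF cost', symmetric]
    by (intro integral_mono integrable.intros[OF R] integrable.intros[OF cost'] gradient_step[OF \<gamma>])
qed

text \<open>Follows from m \<le> L. It is essential for the extended-valued statement, since
  \<open>ennreal\<close> sends negative numbers to 0.\<close>

lemma one_minus_step_nonneg: "0 \<le> 1 - m * \<gamma>" if "0 < \<gamma>" "\<gamma> \<le> 1 / L"
proof -
  have "m * \<gamma> \<le> L * \<gamma>" using L_ge_m that by simp
  also have "\<dots> \<le> 1" using that L_pos by (simp add: field_simps)
  finally show ?thesis by simp
qed

text \<open>The energies depend only on the intermediate law, not on the coupling chosen, so they
  cancel for each \<open>\<xi>\<close> before the infimum is taken. What survives is 2 \<gamma> (L
  \<gamma> d).\<close>

lemma ula_step:
  assumes \<mu>: "\<mu> \<in> P2" and \<gamma>: "0 < \<gamma>" "\<gamma> \<le> 1 / L"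
  shows "bind \<mu> (ula_kernel gradU \<gamma>) \<in> P2"
    and "W2sq (bind \<mu> (ula_kernel gradU \<gamma>)) (gibbs U)
      \<le> ennreal (1 - m * \<gamma>) * W2sq \<mu> (gibbs U) + ennreal (2 * L * DIM('a) * \<gamma>\<^sup>2)"
proof -
  let ?\<mu>' = "distr \<mu> borel (\<lambda>x. x - \<gamma> *\<^sub>R gradU x)"
  have P': "?\<mu>' \<in> P2" by (rule gradient_step_in_P2[OF \<mu>])
  have eq: "bind \<mu> (ula_kernel gradU \<gamma>) = heat_flow \<gamma> ?\<mu>'"
    by (intro bind_ula_kernel measurable_gradU \<gamma> P2_D[OF \<mu>])
  show "bind \<mu> (ula_kernel gradU \<gamma>) \<in> P2"
    unfolding eq by (rule heat_flow_in_P2[OF P' \<gamma>(1)])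
  show "W2sq (bind \<mu> (ula_kernel gradU \<gamma>)) (gibbs U)
      \<le> ennreal (1 - m * \<gamma>) * W2sq \<mu> (gibbs U) + ennreal (2 * L * DIM('a) * \<gamma>\<^sup>2)"
  proof (rule W2sq_affine_bound[OF \<mu> gibbs_in_P2 one_minus_step_nonneg[OF \<gamma>]])
    show "0 \<le> 2 * L * DIM('a) * \<gamma>\<^sup>2" using L_pos by simp
    fix \<xi> assume "\<xi> \<in> couplings \<mu> (gibbs U)"
    from gradient_step_coupling[OF this \<mu> \<gamma>] obtain \<xi>' where
      \<xi>': "\<xi>' \<in> couplings ?\<mu>' (gibbs U)" and
      le: "transport_cost \<xi>' \<le> (1 - m * \<gamma>) * transport_cost \<xi>
        - 2 * \<gamma> * ((\<integral>x. U x \<partial>?\<mu>') - (\<integral>y. U y \<partial>gibbs U))" by blast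
    have "W2sq (heat_flow \<gamma> ?\<mu>') (gibbs U) \<le> ennreal (transport_cost \<xi>'
      + 2 * \<gamma> * ((\<integral>x. U x \<partial>?\<mu>') + L * \<gamma> * DIM('a) - (\<integral>y. U y \<partial>gibbs U)))"
      by (rule heat_flow_W2sq[OF \<xi>' P' \<gamma>(1)])
    also have "\<dots> \<le> ennreal ((1 - m * \<gamma>) * transport_cost \<xi> + 2 * L * DIM('a) * \<gamma>\<^sup>2)"
      using le by (intro ennreal_leI) (simp add: algebra_simps power2_eq_square)
    finally show "W2sq (bind \<mu> (ula_kernel gradU \<gamma>)) (gibbs U)
      \<le> ennreal ((1 - m * \<gamma>) * transport_cost \<xi> + 2 * L * DIM('a) * \<gamma>\<^sup>2)"
      unfolding eq .
  qed
qed

text \<open>The affine recursion of \<open>ula_step\<close> is unrolled. Membership in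
  \<open>P2\<close> belongs to the induction because the next step needs a starting law with finite
  second moment.\<close>

lemma ula_iter_bound:
  fixes \<gamma> :: "nat \<Rightarrow> real"
  assumes \<mu>: "\<mu> \<in> P2" and \<gamma>: "\<And>k. k \<ge> 1 \<Longrightarrow> 0 < \<gamma> k" "\<And>k. k \<ge> 1 \<Longrightarrow> \<gamma> k \<le> 1 / L"
  shows "bind \<mu> (ula_iter gradU \<gamma> n) \<in> P2 \<and>
    W2sq (bind \<mu> (ula_iter gradU \<gamma> n)) (gibbs U)
    \<le> ennreal (\<Prod>k=1..n. 1 - m * \<gamma> k) * W2sq \<mu> (gibbs U)
      + ennreal (2 * L * real DIM('a) * (\<Sum>k=1..n. (\<gamma> k)\<^sup>2 * (\<Prod>i=k+1..n. 1 - m * \<gamma> i)))"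
proof (induction n)
  case 0
  have "ula_iter gradU \<gamma> 0 = return borel" by auto
  then have eq: "bind \<mu> (ula_iter gradU \<gamma> 0) = \<mu>"
    using P2_D(1)[OF \<mu>] by (simp only: bind_return'')
  show ?case unfolding eq using \<mu> by simp
next
  case (Suc n)
  let ?\<mu> = "bind \<mu> (ula_iter gradU \<gamma> n)" and ?c = "2 * L * real DIM('a)"
  let ?a = "1 - m * \<gamma> (Suc n)"
  let ?p = "\<Prod>k=1..n. 1 - m * \<gamma> k" and ?s = "\<Sum>k=1..n. (\<gamma> k)\<^sup>2 * (\<Prod>i=k+1..n. 1 - m * \<gamma> i)"
  have nn: "0 \<le> 1 - m * \<gamma> k" if "k \<ge> 1" for k
    using that \<gamma> by (intro one_minus_step_nonneg)
  have p: "0 \<le> ?p" by (intro prod_nonneg nn) auto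
  have s: "0 \<le> ?s" by (intro sum_nonneg mult_nonneg_nonneg prod_nonneg nn) auto
  have c: "0 \<le> ?c" using L_pos by simp
  have a: "0 \<le> ?a" by (intro nn) simp
  have eq: "bind \<mu> (ula_iter gradU \<gamma> (Suc n)) = bind ?\<mu> (ula_kernel gradU (\<gamma> (Suc n)))"
    by (intro bind_ula_iter_Suc measurable_gradU \<gamma> P2_D[OF \<mu>])
  have step: "0 < \<gamma> (Suc n)" "\<gamma> (Suc n) \<le> 1 / L" by (auto intro: \<gamma>)
  have "W2sq (bind ?\<mu> (ula_kernel gradU (\<gamma> (Suc n)))) (gibbs U)
    \<le> ennreal ?a * W2sq ?\<mu> (gibbs U) + ennreal (?c * (\<gamma> (Suc n))\<^sup>2)"
    using ula_step(2)[OF conjunct1[OF Suc] step] .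
  also have "\<dots> \<le> ennreal ?a * (ennreal ?p * W2sq \<mu> (gibbs U) + ennreal (?c * ?s)) + ennreal (?c * (\<gamma> (Suc n))\<^sup>2)"
    by (intro add_right_mono mult_left_mono conjunct2[OF Suc]) simp
  also have "\<dots> = ennreal (?a * ?p) * W2sq \<mu> (gibbs U) + ennreal (?a * (?c * ?s) + ?c * (\<gamma> (Suc n))\<^sup>2)"
  proof -
    \<comment> \<open>\<open>ennreal\<close> respects sums and products of nonnegative reals only;
      this is why the signs of all factors were collected beforehand.\<close>
    have "ennreal a * (ennreal p * X + ennreal q) + ennreal r = ennreal (a * p) * X + ennreal (a * q + r)"
      if "0 \<le> a" "0 \<le> p" "0 \<le> q" "0 \<le> r" for a p q r :: real and X
      using that by (simp add: distrib_left ennreal_mult mult.assoc add.assoc)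
    then show ?thesis using a p s c by (meson mult_nonneg_nonneg zero_le_power2)
  qed
  also have "?a * ?p = (\<Prod>k=1..Suc n. 1 - m * \<gamma> k)" by simp
  also have "?a * (?c * ?s) + ?c * (\<gamma> (Suc n))\<^sup>2
    = ?c * (\<Sum>k=1..Suc n. (\<gamma> k)\<^sup>2 * (\<Prod>i=k+1..Suc n. 1 - m * \<gamma> i))"
  proof -
    \<comment> \<open>Each old summand gains the factor of the new index, while the new summand
      \<open>k = Suc n\<close> carries an empty product and enters with weight 1.\<close>
    have "(\<Sum>k=1..n. (\<gamma> k)\<^sup>2 * (\<Prod>i=k+1..Suc n. 1 - m * \<gamma> i)) = (\<Sum>k=1..n. ?a * ((\<gamma> k)\<^sup>2 * (\<Prod>i=k+1..n. 1 - m * \<gamma> i)))"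
      by (intro sum.cong refl) (auto simp: mult_ac)
    also have "\<dots> = ?a * ?s" by (rule sum_distrib_left[symmetric])
    finally have "(\<Sum>k=1..Suc n. (\<gamma> k)\<^sup>2 * (\<Prod>i=k+1..Suc n. 1 - m * \<gamma> i)) = ?a * ?s + (\<gamma> (Suc n))\<^sup>2"
      by (subst sum.cl_ivl_Suc) simp
    then show ?thesis by (simp only: distrib_left mult.left_commute)
  qed
  finally show ?case
    unfolding eq using ula_step(1)[OF conjunct1[OF Suc] step] by blast
qed

end

theorem theorem9:
  fixes U :: "'a::euclidean_space \<Rightarrow> real" and gradU :: "'a \<Rightarrow> 'a"
    and m L :: real and \<gamma> :: "nat \<Rightarrow> real" and \<mu>0 :: "'a measure" and n :: nat
  assumes "m > 0"
    and "m_convex m U"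
    and "\<And>x. GDERIV U x :> gradU x"
    and "continuous_on UNIV gradU"
    and "\<And>x y. norm (gradU x - gradU y) \<le> L * norm (x - y)"
    and "\<And>k. k \<ge> 1 \<Longrightarrow> \<gamma> k > 0"
    and "antimono_on {1..} \<gamma>"
    and "\<gamma> 1 \<in> {0<..inverse L}"
    and "\<mu>0 \<in> P2"
    and "n \<ge> 1"
  shows "(W2 (bind \<mu>0 (ula_iter gradU \<gamma> n)) (gibbs U))\<^sup>2
    \<le> ennreal (\<Prod>k=1..n. 1 - m * \<gamma> k) * (W2 \<mu>0 (gibbs U))\<^sup>2
      + ennreal (2 * L * real DIM('a) *
          (\<Sum>k=1..n. (\<gamma> k)\<^sup>2 * (\<Prod>i=k+1..n. 1 - m * \<gamma> i)))"
proof -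
  interpret strongly_convex_potential U gradU m L
    by unfold_locales (fact assms)+
  \<comment> \<open>Monotonicity spreads the bound on the first step size to all of them.\<close>
  have "\<gamma> k \<le> 1 / L" if "k \<ge> 1" for k
    using monotone_onD[OF assms(7), of 1 k] that assms(8) by (simp add: inverse_eq_divide)
  from ula_iter_bound[where \<gamma>=\<gamma> and n=n, OF assms(9,6) this] show ?thesis
    unfolding W2_power2 by blast
qed

end
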